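(* Let $R:S^1\to\mathbb{R}$ satisfy the standing assumptions in the context, let $p\in\mathcal{P}$ be even, and let $\epsilon\in\{1,-1\}$ be such that $Y_{p\epsilon}(q)\neq\emptyset$ for some non-negative integer $q$. Then the representation of $\mathcal{A}_{\mathrm{obs}}$ on $\mathcal{H}_{\mathrm{RAQ}}^{p\epsilon}$ is irreducible: every linear subspace $V\subset\mathcal{H}_{\mathrm{RAQ}}^{p\epsilon}$ with $V\neq\{0\}$ that is invariant under $\mathcal{A}_{\mathrm{obs}}$ equals $\mathcal{H}_{\mathrm{RAQ}}^{p\epsilon}$.
   Context: $S^1=\mathbb{R}/2\pi\mathbb{Z}$, and $\mathcal{C}=S^1\times S^1$ has coordinates $(x,y)$. Standing assumptions on $R:S^1\to\mathbb{R}$: $R$ is smooth, is positive somewhere, has at most finitely many stationary points (points with $R'=0$), at each stationary point some derivative of $R$ (of order $\ge 1$) is nonvanishing, no zero of $R$ is a stationary point, the equation $q^2=R(y)$ has a solution for some non-negative integer $q$, and the set $\mathcal{P}$ defined below has the property: if $p\in\mathcal{P}$, then $\mathcal{P}$ contains no factors (positive divisors) of $p$ smaller than $p/2$. $\mathcal{H}_{\mathrm{aux}}=L^2(\mathcal{C},dx\,dy)$. The constraint operator $\hat C=-\partial^2/\partial x^2-R(y)$ is essentially self-adjoint, and $U(t):=e^{-it\hat C}$, $t\in\mathbb{R}$. The test space $\Phi\subset\mathcal{H}_{\mathrm{aux}}$ is the dense subspace of functions $f(x,y)=\sum_{m\in\mathbb{Z}}e^{imx}f_m(y)$ with each $f_m:S^1\to\mathbb{C}$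 smooth and only finitely many $f_m$ nonzero. It is invariant under $U(t)$: $(U(t)f)(x,y)=\sum_m e^{-it[m^2-R(y)]}e^{imx}f_m(y)$. $\Phi^*$ is the algebraic dual of $\Phi$; $\xi[g]$ denotes the action of $\xi\in\Phi^*$ on $g\in\Phi$. $\mathcal{A}_{\mathrm{obs}}$ is the algebra of (linear, densely defined) operators $\mathcal{O}$ on $\mathcal{H}_{\mathrm{aux}}$ such that the domains of $\mathcal{O}$ and its adjoint $\mathcal{O}^\dagger$ include $\Phi$, both $\mathcal{O}$ and $\mathcal{O}^\dagger$ map $\Phi$ into $\Phi$, and $\mathcal{O}$ commutes with $U(t)$ on $\Phi$ for all $t\in\mathbb{R}$. For a non-negative integer $q$ and a solution $y$ of $q^2=R(y)$, the order of $y$ is the order $p\ge1$ of the lowest nonvanishing derivative (of order $\ge1$) of $R$ at $y$. For even $p$ and $\epsilon\in\{1,-1\}$, $Y_{p\epsilon}(q)$ is the (finite) set of solutions of $q^2=R(y)$ of order $p$ at which $R^{(p)}(y)$ has sign $\epsilon$. $\mathcal{P}$ is the set of all orders occurring for solutions of $q^2=R(y)$, over all non-negative integers $q$. The antilinear map $\eta_{p\epsilon}:\Phi\to\Phi^*$ is $$\eta_{p\epsilon}(f)[g]=(2\pi)^2\sum_{m\in\mathbb{Z}}\sum_{y\in Y_{p\epsilon}(|m|)}\frac{\overline{f_m(y)}\,g_m(y)}{|R^{(p)}(y)|^{1/p}},\qquad f,g\in\Phi .$$ It satisfies $\eta_{p\epsilon}(\mathcal{O}f)[g]=\eta_{p\epsilon}(f)[\mathcal{O}^\dagger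 g]$ for all $\mathcal{O}\in\mathcal{A}_{\mathrm{obs}}$, $f,g\in\Phi$. $\mathcal{H}_{\mathrm{RAQ}}^{p\epsilon}:=\eta_{p\epsilon}(\Phi)$ is the (finite-dimensional) Hilbert space with inner product $(\eta_{p\epsilon}(\phi_1),\eta_{p\epsilon}(\phi_2))_{\mathrm{RAQ}}:=\eta_{p\epsilon}(\phi_2)[\phi_1]$, and $\mathcal{O}\in\mathcal{A}_{\mathrm{obs}}$ acts on it by $\eta_{p\epsilon}(\phi)\mapsto\eta_{p\epsilon}(\mathcal{O}\phi)$. A subspace $V$ is invariant under $\mathcal{A}_{\mathrm{obs}}$ if $\eta_{p\epsilon}(\phi)\in V$ implies $\eta_{p\epsilon}(\mathcal{O}\phi)\in V$ for all $\mathcal{O}\in\mathcal{A}_{\mathrm{obs}}$. *)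

theory Defs
  imports "HOL-Analysis.Analysis"
begin

section \<open>The auxiliary Hilbert space\<close>

text \<open>Functions on the circle \<open>S\<^sup>1\<close> of length \<open>2\<pi>\<close> are \<open>2\<pi>\<close>-periodic functions on the reals,
  and a point of the circle is its representative in \<open>[0, 2\<pi>)\<close>. The torus \<open>S\<^sup>1 \<times> S\<^sup>1\<close> with
  \<open>dx dy\<close> is Lebesgue measure on the fundamental domain.\<close>

definition circle :: "real set" where
  "circle = {0..<2 * pi}"

definition torus :: "(real \<times> real) measure" where
  "torus = restrict_space lborel (circle \<times> circle)"

definition square_integrable :: "(real \<times> real \<Rightarrow> complex) \<Rightarrow> bool" where
  "square_integrable f \<longleftrightarrow> f \<in> borel_measurable torus \<and> integrable torus (\<lambda>z. (cmod (f z))\<^sup>2)"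

definition ae_equal :: "(real \<times> real \<Rightarrow> complex) \<Rightarrow> (real \<times> real \<Rightarrow> complex) \<Rightarrow> bool" where
  "ae_equal f g \<longleftrightarrow> square_integrable f \<and> square_integrable g \<and> (AE z in torus. f z = g z)"

lemma square_integrable_zero: "square_integrable (\<lambda>_. 0)"
  by (simp add: square_integrable_def)

lemma square_integrable_scale:
  assumes "square_integrable f"
  shows "square_integrable (\<lambda>z. a * f z)"
  using assms by (auto simp: square_integrable_def norm_mult power_mult_distrib)

lemma square_integrable_add:
  assumes "square_integrable f" "square_integrable g"
  shows "square_integrable (\<lambda>z. f z + g z)"
proof -
  have [measurable]: "f \<in> borel_measurable torus" "g \<in> borel_measurable torus"
    using assms by (auto simp: square_integrable_def)
  have int: "integrable torus (\<lambda>z. 2 * (cmod (f z))\<^sup>2 + 2 * (cmod (g z))\<^sup>2)"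
    using assms by (auto simp: square_integrable_def)
  have bound: "(cmod (f z + g z))\<^sup>2 \<le> 2 * (cmod (f z))\<^sup>2 + 2 * (cmod (g z))\<^sup>2" for z
  proof -
    have "(cmod (f z + g z))\<^sup>2 \<le> (cmod (f z) + cmod (g z))\<^sup>2"
      by (intro power_mono norm_triangle_ineq) auto
    also have "\<dots> \<le> 2 * (cmod (f z))\<^sup>2 + 2 * (cmod (g z))\<^sup>2"
      using sum_squares_bound[of "cmod (f z)" "cmod (g z)"] by (simp add: power2_sum)
    finally show ?thesis .
  qed
  have "integrable torus (\<lambda>z. (cmod (f z + g z))\<^sup>2)"
    by (rule Bochner_Integration.integrable_bound[OF int]) (use bound in \<open>auto intro!: AE_I2\<close>)
  then show ?thesis
    by (simp add: square_integrable_def)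
qed

quotient_type haux = "real \<times> real \<Rightarrow> complex" / partial: ae_equal
proof (rule part_equivpI)
  show "\<exists>f. ae_equal f f"
    using square_integrable_zero by (auto simp: ae_equal_def)
  show "symp ae_equal"
    by (auto simp: symp_def ae_equal_def eq_commute)
  show "transp ae_equal"
    by (auto simp: transp_def ae_equal_def)
qed

instantiation haux :: ab_group_add
begin

lift_definition zero_haux :: haux is "\<lambda>_. 0"
  by (simp add: ae_equal_def square_integrable_zero)

lift_definition plus_haux :: "haux \<Rightarrow> haux \<Rightarrow> haux" is "\<lambda>f g z. f z + g z"
  by (auto simp: ae_equal_def square_integrable_add)

lift_definition uminus_haux :: "haux \<Rightarrow> haux" is "\<lambda>f z. - f z"
  using square_integrable_scale[of _ "-1"] by (auto simp: ae_equal_def)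

definition minus_haux :: "haux \<Rightarrow> haux \<Rightarrow> haux" where
  "minus_haux f g = f + (- g)"

instance
proof
  fix a b c :: haux
  show "a + b + c = a + (b + c)"
    by transfer (auto simp: ae_equal_def square_integrable_add add.assoc)
  show "a + b = b + a"
    by transfer (auto simp: ae_equal_def square_integrable_add add.commute)
  show "0 + a = a"
    by transfer (auto simp: ae_equal_def)
  show "- a + a = 0"
    by transfer (auto simp: ae_equal_def square_integrable_zero)
  show "a - b = a + - b"
    by (rule minus_haux_def)
qed

end

lift_definition cscale :: "complex \<Rightarrow> haux \<Rightarrow> haux" is "\<lambda>a f z. a * f z"
  by (auto simp: ae_equal_def square_integrable_scale)

lift_definition l2_inner :: "haux \<Rightarrow> haux \<Rightarrow> complex" is
  "\<lambda>f g. integral\<^sup>L torus (\<lambda>z. cnj (f z) * g z)"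
proof -
  fix f f' g g'
  assume "ae_equal f f'" "ae_equal g g'"
  then have ae: "AE z in torus. cnj (f z) * g z = cnj (f' z) * g' z"
    and [measurable]: "f \<in> borel_measurable torus" "f' \<in> borel_measurable torus"
      "g \<in> borel_measurable torus" "g' \<in> borel_measurable torus"
    by (auto simp: ae_equal_def square_integrable_def)
  have "cnj \<in> borel_measurable borel"
    by (intro borel_measurable_continuous_onI continuous_intros)
  then have cnj_measurable: "(\<lambda>z. cnj (h z)) \<in> borel_measurable torus"
    if "h \<in> borel_measurable torus" for h :: "real \<times> real \<Rightarrow> complex"
    using measurable_compose[OF that] by blast
  have "(\<lambda>z. cnj (f z) * g z) \<in> borel_measurable torus"
    and "(\<lambda>z. cnj (f' z) * g' z) \<in> borel_measurable torus"
    using cnj_measurable by (auto intro: borel_measurable_times)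
  then show "integral\<^sup>L torus (\<lambda>z. cnj (f z) * g z) = integral\<^sup>L torus (\<lambda>z. cnj (f' z) * g' z)"
    using ae by (rule integral_cong_AE)
qed

section \<open>Test space and evolution\<close>

definition nderiv :: "nat \<Rightarrow> (real \<Rightarrow> 'a::real_normed_vector) \<Rightarrow> real \<Rightarrow> 'a" where
  "nderiv n f = ((\<lambda>g t. vector_derivative g (at t)) ^^ n) f"

definition smooth_on_circle :: "(real \<Rightarrow> 'a::real_normed_vector) \<Rightarrow> bool" where
  "smooth_on_circle f \<longleftrightarrow>
     (\<forall>t. f (t + 2 * pi) = f t) \<and> (\<forall>n. nderiv n f differentiable_on UNIV)"

text \<open>An element of the test space is given by its family of modes \<open>f\<^sub>m\<close>.\<close>

definition mode_families :: "(int \<Rightarrow> real \<Rightarrow> complex) set" where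
  "mode_families = {c. finite {m. c m \<noteq> (\<lambda>_. 0)} \<and> (\<forall>m. smooth_on_circle (c m))}"

definition mode_sum :: "(int \<Rightarrow> real \<Rightarrow> complex) \<Rightarrow> real \<times> real \<Rightarrow> complex" where
  "mode_sum c = (\<lambda>(x, y). \<Sum>m | c m \<noteq> (\<lambda>_. 0). exp (\<i> * of_int m * of_real x) * c m y)"

definition test_space :: "haux set" where
  "test_space = {abs_haux (mode_sum c) | c. c \<in> mode_families}"

definition mode :: "haux \<Rightarrow> int \<Rightarrow> real \<Rightarrow> complex" where
  "mode f = (THE c. c \<in> mode_families \<and> f = abs_haux (mode_sum c))"

text \<open>The constraint operator \<open>-\<partial>\<^sup>2/\<partial>x\<^sup>2 - R(y)\<close> on smooth functions. On a mode it acts as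
  multiplication by \<open>m\<^sup>2 - R(y)\<close>, so that its unitary group acts on the test space as in
  \<open>evolution\<close>; the lemma \<open>evolution_solves_schroedinger\<close> below confirms this pointwise.\<close>

definition constraint_op ::
  "(real \<Rightarrow> real) \<Rightarrow> (real \<times> real \<Rightarrow> complex) \<Rightarrow> real \<times> real \<Rightarrow> complex" where
  "constraint_op R f = (\<lambda>(x, y). - nderiv 2 (\<lambda>s. f (s, y)) x - of_real (R y) * f (x, y))"

definition evolve_modes ::
  "(real \<Rightarrow> real) \<Rightarrow> real \<Rightarrow> (int \<Rightarrow> real \<Rightarrow> complex) \<Rightarrow> int \<Rightarrow> real \<Rightarrow> complex" where
  "evolve_modes R t c = (\<lambda>m y. exp (- \<i> * of_real (t * ((of_int m)\<^sup>2 - R y))) * c m y)"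

definition evolution :: "(real \<Rightarrow> real) \<Rightarrow> real \<Rightarrow> haux \<Rightarrow> haux" where
  "evolution R t f = abs_haux (mode_sum (evolve_modes R t (mode f)))"

lemma nderiv_2_mode_sum:
  "nderiv 2 (\<lambda>s. mode_sum c (s, y)) x =
     (\<Sum>m | c m \<noteq> (\<lambda>_. 0). - (of_int m)\<^sup>2 * (exp (\<i> * of_int m * of_real x) * c m y))"
proof -
  let ?S = "{m. c m \<noteq> (\<lambda>_. 0)}"
  have 1: "((\<lambda>s. \<Sum>m\<in>?S. a m * (exp (\<i> * of_int m * of_real s) * c m y)) has_vector_derivative
      (\<Sum>m\<in>?S. (a m * (\<i> * of_int m)) * (exp (\<i> * of_int m * of_real s) * c m y))) (at s)"
    for a :: "int \<Rightarrow> complex" and s :: real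
  proof (rule has_vector_derivative_sum)
    fix m
    have "((\<lambda>z. a m * (exp (\<i> * of_int m * z) * c m y)) has_field_derivative
        (a m * (\<i> * of_int m)) * (exp (\<i> * of_int m * of_real s) * c m y)) (at (of_real s))"
      by (auto intro!: derivative_eq_intros)
    then show "((\<lambda>s. a m * (exp (\<i> * of_int m * of_real s) * c m y)) has_vector_derivative
        (a m * (\<i> * of_int m)) * (exp (\<i> * of_int m * of_real s) * c m y)) (at s)"
      by (rule has_vector_derivative_real_field)
  qed
  have d1: "vector_derivative (\<lambda>s. mode_sum c (s, y)) (at s) =
      (\<Sum>m\<in>?S. (\<i> * of_int m) * (exp (\<i> * of_int m * of_real s) * c m y))" for s
    using vector_derivative_at[OF 1[where a = "\<lambda>_. 1"]] by (simp add: mode_sum_def)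
  have "nderiv 2 (\<lambda>s. mode_sum c (s, y)) x =
      vector_derivative (\<lambda>s. vector_derivative (\<lambda>s. mode_sum c (s, y)) (at s)) (at x)"
    by (simp add: nderiv_def numeral_2_eq_2)
  also have "\<dots> = (\<Sum>m\<in>?S. (\<i> * of_int m * (\<i> * of_int m)) *
      (exp (\<i> * of_int m * of_real x) * c m y))"
    unfolding d1 by (rule vector_derivative_at[OF 1])
  also have "\<dots> = (\<Sum>m\<in>?S. - (of_int m)\<^sup>2 * (exp (\<i> * of_int m * of_real x) * c m y))"
  proof (rule sum.cong[OF refl])
    fix m
    have "\<i> * of_int m * (\<i> * of_int m) = (\<i> * \<i>) * (of_int m)\<^sup>2"
      by (simp only: power2_eq_square mult.assoc mult.left_commute)
    then show "\<i> * of_int m * (\<i> * of_int m) * (exp (\<i> * of_int m * of_real x) * c m y) =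
        - (of_int m)\<^sup>2 * (exp (\<i> * of_int m * of_real x) * c m y)"
      by (simp only: complex_i_mult_minus i_squared) simp
  qed
  finally show ?thesis .
qed

lemma evolve_modes_support:
  "{m. evolve_modes R t c m \<noteq> (\<lambda>_. 0)} = {m. c m \<noteq> (\<lambda>_. 0)}"
  by (auto simp: evolve_modes_def fun_eq_iff)

lemma evolution_solves_schroedinger:
  "mode_sum (evolve_modes R 0 c) = mode_sum c"
  "((\<lambda>t. mode_sum (evolve_modes R t c) z) has_vector_derivative
      - \<i> * constraint_op R (mode_sum (evolve_modes R t c)) z) (at t)"
proof -
  show "mode_sum (evolve_modes R 0 c) = mode_sum c"
    by (simp add: evolve_modes_def)
  obtain x y where z: "z = (x, y)" by fastforce
  let ?S = "{m. c m \<noteq> (\<lambda>_. 0)}"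
  let ?k = "\<lambda>m. (of_int m)\<^sup>2 - R y"
  have "((\<lambda>t. \<Sum>m\<in>?S. exp (\<i> * of_int m * of_real x) * evolve_modes R t c m y)
      has_vector_derivative
      (\<Sum>m\<in>?S. - \<i> * of_real (?k m) * (exp (\<i> * of_int m * of_real x) * evolve_modes R t c m y))) (at t)"
  proof (rule has_vector_derivative_sum)
    fix m
    have "((\<lambda>w. exp (\<i> * of_int m * of_real x) * (exp (- \<i> * (w * of_real (?k m))) * c m y))
        has_field_derivative - \<i> * of_real (?k m) * (exp (\<i> * of_int m * of_real x) *
          (exp (- \<i> * (of_real t * of_real (?k m))) * c m y))) (at (of_real t))"
      by (auto intro!: derivative_eq_intros)
    from has_vector_derivative_real_field[OF this]
    show "((\<lambda>t. exp (\<i> * of_int m * of_real x) * evolve_modes R t c m y) has_vector_derivative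
        - \<i> * of_real (?k m) * (exp (\<i> * of_int m * of_real x) * evolve_modes R t c m y)) (at t)"
      by (simp add: evolve_modes_def)
  qed
  moreover have "- \<i> * constraint_op R (mode_sum (evolve_modes R t c)) z =
      (\<Sum>m\<in>?S. - \<i> * of_real (?k m) * (exp (\<i> * of_int m * of_real x) * evolve_modes R t c m y))"
  proof -
    let ?e = "\<lambda>m. exp (\<i> * of_int m * of_real x) * evolve_modes R t c m y"
    have "constraint_op R (mode_sum (evolve_modes R t c)) z =
        - (\<Sum>m\<in>?S. - (of_int m)\<^sup>2 * ?e m) - of_real (R y) * (\<Sum>m\<in>?S. ?e m)"
      unfolding constraint_op_def z prod.case nderiv_2_mode_sum evolve_modes_support
      by (simp add: mode_sum_def evolve_modes_support)
    also have "\<dots> = (\<Sum>m\<in>?S. - (- (of_int m)\<^sup>2 * ?e m) - of_real (R y) * ?e m)"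
      by (simp only: sum_negf sum_subtractf sum_distrib_left)
    also have "\<dots> = (\<Sum>m\<in>?S. of_real (?k m) * ?e m)"
      by (intro sum.cong refl) (simp add: left_diff_distrib)
    finally show ?thesis
      by (simp only: sum_distrib_left mult.assoc)
  qed
  ultimately show "((\<lambda>t. mode_sum (evolve_modes R t c) z) has_vector_derivative
      - \<i> * constraint_op R (mode_sum (evolve_modes R t c)) z) (at t)"
    by (simp add: mode_sum_def z evolve_modes_support)
qed

section \<open>The algebra of observables\<close>

text \<open>A linear operator in \<open>L\<^sup>2\<close> with a possibly smaller domain is represented by its graph:
  \<open>(f, g) \<in> A\<close> means that \<open>f\<close> is in the domain and \<open>A f = g\<close>.\<close>

definition linear_operator :: "(haux \<times> haux) set \<Rightarrow> bool" where
  "linear_operator A \<longleftrightarrow>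
     single_valued A \<and> (0, 0) \<in> A \<and>
     (\<forall>f g f' g'. (f, g) \<in> A \<longrightarrow> (f', g') \<in> A \<longrightarrow> (f + f', g + g') \<in> A) \<and>
     (\<forall>a f g. (f, g) \<in> A \<longrightarrow> (cscale a f, cscale a g) \<in> A)"

definition adjoint_op :: "(haux \<times> haux) set \<Rightarrow> (haux \<times> haux) set" where
  "adjoint_op A = {(h, k). \<forall>f g. (f, g) \<in> A \<longrightarrow> l2_inner h g = l2_inner k f}"

definition preserves :: "(haux \<times> haux) set \<Rightarrow> haux set \<Rightarrow> bool" where
  "preserves A S \<longleftrightarrow> (\<forall>f\<in>S. \<exists>g\<in>S. (f, g) \<in> A)"

text \<open>Density of the domain is not listed, since the domain contains the dense test space.\<close>

definition observables :: "(real \<Rightarrow> real) \<Rightarrow> (haux \<times> haux) set set" where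
  "observables R = {A. linear_operator A \<and>
     preserves A test_space \<and> preserves (adjoint_op A) test_space \<and>
     (\<forall>t. \<forall>f\<in>test_space. \<forall>g. (f, g) \<in> A \<longrightarrow> (evolution R t f, evolution R t g) \<in> A)}"

section \<open>The potential\<close>

definition order_at :: "(real \<Rightarrow> real) \<Rightarrow> real \<Rightarrow> nat" where
  "order_at R y = (LEAST p. 1 \<le> p \<and> nderiv p R y \<noteq> 0)"

definition solutions :: "(real \<Rightarrow> real) \<Rightarrow> nat \<Rightarrow> real set" where
  "solutions R q = {y \<in> circle. (real q)\<^sup>2 = R y}"

definition orders :: "(real \<Rightarrow> real) \<Rightarrow> nat set" where
  "orders R = {order_at R y | y q. y \<in> solutions R q}"

definition signed_solutions :: "(real \<Rightarrow> real) \<Rightarrow> nat \<Rightarrow> real \<Rightarrow> nat \<Rightarrow> real set" where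
  "signed_solutions R p \<epsilon> q =
     {y \<in> solutions R q. order_at R y = p \<and> sgn (nderiv p R y) = \<epsilon>}"

definition admissible_potential :: "(real \<Rightarrow> real) \<Rightarrow> bool" where
  "admissible_potential R \<longleftrightarrow>
     smooth_on_circle R \<and>
     (\<exists>y. R y > 0) \<and>
     finite {y \<in> circle. nderiv 1 R y = 0} \<and>
     (\<forall>y. nderiv 1 R y = 0 \<longrightarrow> (\<exists>n\<ge>1. nderiv n R y \<noteq> 0)) \<and>
     (\<forall>y. R y = 0 \<longrightarrow> nderiv 1 R y \<noteq> 0) \<and>
     (\<exists>q. solutions R q \<noteq> {}) \<and>
     (\<forall>p\<in>orders R. \<forall>d\<in>orders R. d dvd p \<longrightarrow> \<not> real d < real p / 2)"

section \<open>Refined algebraic quantisation\<close>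

text \<open>A functional on the test space is a function on \<open>haux\<close> that is \<open>0\<close> off the test space, so
  that equality of functions is equality in the algebraic dual. The sum over modes is finite.\<close>

definition rigging_map ::
  "(real \<Rightarrow> real) \<Rightarrow> nat \<Rightarrow> real \<Rightarrow> haux \<Rightarrow> haux \<Rightarrow> complex" where
  "rigging_map R p \<epsilon> f = (\<lambda>g. if g \<in> test_space then
     of_real ((2 * pi)\<^sup>2) * (\<Sum>\<^sub>\<infinity>m. \<Sum>y\<in>signed_solutions R p \<epsilon> (nat \<bar>m\<bar>).
       cnj (mode f m y) * mode g m y / of_real (\<bar>nderiv p R y\<bar> powr (1 / real p)))
     else 0)"

definition raq_space :: "(real \<Rightarrow> real) \<Rightarrow> nat \<Rightarrow> real \<Rightarrow> (haux \<Rightarrow> complex) set" where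
  "raq_space R p \<epsilon> = rigging_map R p \<epsilon> ` test_space"

definition linear_subspace :: "(haux \<Rightarrow> complex) set \<Rightarrow> bool" where
  "linear_subspace V \<longleftrightarrow>
     (\<lambda>_. 0) \<in> V \<and>
     (\<forall>\<xi>\<in>V. \<forall>\<zeta>\<in>V. (\<lambda>g. \<xi> g + \<zeta> g) \<in> V) \<and>
     (\<forall>a. \<forall>\<xi>\<in>V. (\<lambda>g. a * \<xi> g) \<in> V)"

text \<open>The observable \<open>A\<close> acts by mapping the image of \<open>f\<close> to the image of \<open>A f\<close>.\<close>

definition invariant_subspace ::
  "(real \<Rightarrow> real) \<Rightarrow> nat \<Rightarrow> real \<Rightarrow> (haux \<Rightarrow> complex) set \<Rightarrow> bool" where
  "invariant_subspace R p \<epsilon> V \<longleftrightarrow>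
     (\<forall>A\<in>observables R. \<forall>f\<in>test_space. \<forall>g. (f, g) \<in> A \<longrightarrow>
        rigging_map R p \<epsilon> f \<in> V \<longrightarrow> rigging_map R p \<epsilon> g \<in> V)"

end

theory Submission
  imports Defs
begin

text \<open>Idea. A vector of the quantised space is determined by the values of the modes at the finitely
  many relevant points \<open>(m, y)\<close> with \<open>R y = m\<^sup>2\<close>, so it suffices to realise all matrix units between
  these points by observables. Near a point of order \<open>p\<close> and sign \<open>\<epsilon>\<close> there is a smooth coordinate \<open>s\<close>
  in which \<open>R = m\<^sup>2 + \<epsilon> s\<^sup>p\<close>. Matching the coordinates of two such points gives a local
  diffeomorphism that intertwines \<open>m\<^sub>1\<^sup>2 - R\<close> with \<open>m\<^sub>2\<^sup>2 - R\<close>; pulling the mode \<open>m\<^sub>1\<close> back along it, with a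
  smooth cutoff, and placing the result in the mode \<open>m\<^sub>2\<close> therefore commutes with the evolution, and so does
  the adjoint, which is of the same form with the Jacobian as an extra weight.\<close>

section \<open>Smooth functions of a real variable\<close>

text \<open>Commutation with the evolution is an identity of functions on the whole support of the
  transported mode, for every time. Agreement of \<open>R\<close> at two points, or of finitely many
  Taylor coefficients, is therefore too weak: \<open>m1^2 - R\<close> and \<open>m2^2 - R\<close>
  must coincide exactly in matched coordinates. The normal form provides this, and its only data
  besides the value of \<open>R\<close> are \<open>p\<close> and \<open>\<epsilon>\<close>, which
  explains why the sectors are separated by precisely these two labels. The normal form does a
  second job: \<open>\<epsilon> * s ^ p\<close> vanishes only at \<open>s = 0\<close>, so the
  transported mode sees no solution of \<open>R y = m2^2\<close> other than the target point. One
  such observable, applied to a single vector with a nonvanishing coefficient at the source, thus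
  isolates one evaluation functional, and these functionals span the space. Charts are taken
  orientation preserving, so Jacobians enter without absolute values.\<close>

primrec Ck_on :: "nat \<Rightarrow> real set \<Rightarrow> (real \<Rightarrow> 'a::real_normed_vector) \<Rightarrow> bool" where
  "Ck_on 0 S f \<longleftrightarrow> (\<forall>t\<in>S. isCont f t)"
| "Ck_on (Suc n) S f \<longleftrightarrow>
     (\<forall>t\<in>S. f differentiable at t) \<and> Ck_on n S (\<lambda>t. vector_derivative f (at t))"

definition smooth_on :: "real set \<Rightarrow> (real \<Rightarrow> 'a::real_normed_vector) \<Rightarrow> bool" where
  "smooth_on S f \<longleftrightarrow> (\<forall>n. Ck_on n S f)"

text \<open>Holds because the derivatives in \<open>Ck_on\<close> are taken in the whole line, even
  when \<open>S\<close> is not open. Restriction and gluing (\<open>Ck_on_subset\<close>,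
  \<open>smooth_on_local\<close>) both rest on it.\<close>

lemma Ck_on_pointwise: "Ck_on n S f \<longleftrightarrow> (\<forall>t\<in>S. Ck_on n {t} f)"
  by (induction n arbitrary: f) auto

lemma Ck_on_subset: "Ck_on n S f \<Longrightarrow> T \<subseteq> S \<Longrightarrow> Ck_on n T f"
  using Ck_on_pointwise[of n S f] Ck_on_pointwise[of n T f] by auto

text \<open>Openness turns equality on \<open>S\<close> into equality of germs, which is what
  derivatives in the whole line depend on.\<close>

lemma Ck_on_cong:
  assumes "open S" "\<And>t. t \<in> S \<Longrightarrow> f t = g t" "Ck_on n S f"
  shows "Ck_on n S g"
  using assms(2,3)
proof (induction n arbitrary: f g)
  case 0
  have "isCont g t" if "t \<in> S" for t
  proof -
    have "continuous_on S f"
      using 0(2) continuous_at_imp_continuous_on by auto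
    then have "continuous_on S g"
      using 0(1) continuous_on_cong[of S S f g] by simp
    then show ?thesis
      using that assms(1) continuous_on_eq_continuous_at by blast
  qed
  then show ?case by simp
next
  case (Suc n)
  have d: "(g has_vector_derivative vector_derivative f (at t)) (at t)" if "t \<in> S" for t
  proof (rule has_vector_derivative_transform_within_open[OF _ assms(1) that])
    show "(f has_vector_derivative vector_derivative f (at t)) (at t)"
      using Suc.prems(2) that by (simp add: vector_derivative_works)
  qed (use Suc.prems in auto)
  have "Ck_on n S (\<lambda>t. vector_derivative g (at t))"
  proof (rule Suc.IH)
    show "Ck_on n S (\<lambda>t. vector_derivative f (at t))"
      using Suc.prems(2) by simp
    show "vector_derivative f (at t) = vector_derivative g (at t)" if "t \<in> S" for t
      using vector_derivative_at[OF d[OF that]] by simp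
  qed
  then show ?case
    using d differentiableI_vector by auto
qed

text \<open>The rule behind the inductions below: exhibit the derivative in closed form and show
  that it belongs to a family already covered by the induction hypothesis.\<close>

lemma Ck_on_SucI:
  assumes "open S" "\<And>t. t \<in> S \<Longrightarrow> (f has_vector_derivative f' t) (at t)" "Ck_on n S f'"
  shows "Ck_on (Suc n) S f"
proof -
  have "Ck_on n S (\<lambda>t. vector_derivative f (at t))"
    by (rule Ck_on_cong[OF assms(1) _ assms(3)]) (simp add: vector_derivative_at[OF assms(2)])
  then show ?thesis
    using assms(2) differentiableI_vector by auto
qed

lemma Ck_on_SucD:
  assumes "Ck_on (Suc n) S f" "t \<in> S"
  shows "(f has_vector_derivative vector_derivative f (at t)) (at t)"
  using assms by (simp add: vector_derivative_works)

lemma Ck_on_Suc_lower: "Ck_on (Suc n) S f \<Longrightarrow> Ck_on n S f"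
proof (induction n arbitrary: f)
  case 0
  then show ?case
    by (auto simp: differentiable_imp_continuous_within)
next
  case (Suc n)
  then show ?case by simp
qed

lemma Ck_on_imp_isCont: "Ck_on n S f \<Longrightarrow> t \<in> S \<Longrightarrow> isCont f t"
proof (induction n)
  case (Suc n)
  then show ?case using Ck_on_Suc_lower by blast
qed simp

lemma smooth_on_deriv: "smooth_on S f \<Longrightarrow> smooth_on S (\<lambda>t. vector_derivative f (at t))"
  unfolding smooth_on_def using Ck_on.simps(2) by blast

lemma smooth_on_has_vector_derivative:
  "smooth_on S f \<Longrightarrow> t \<in> S \<Longrightarrow> (f has_vector_derivative vector_derivative f (at t)) (at t)"
  unfolding smooth_on_def using Ck_on_SucD by blast

lemma smooth_on_isCont: "smooth_on S f \<Longrightarrow> t \<in> S \<Longrightarrow> isCont f t"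
  unfolding smooth_on_def using Ck_on.simps(1) by blast

lemma smooth_on_continuous_on: "smooth_on S f \<Longrightarrow> continuous_on S f"
  by (simp add: continuous_at_imp_continuous_on smooth_on_isCont)

lemma smooth_on_subset: "smooth_on S f \<Longrightarrow> T \<subseteq> S \<Longrightarrow> smooth_on T f"
  unfolding smooth_on_def using Ck_on_subset by blast

lemma smooth_on_cong:
  "smooth_on S f \<Longrightarrow> open S \<Longrightarrow> (\<And>t. t \<in> S \<Longrightarrow> f t = g t) \<Longrightarrow> smooth_on S g"
  unfolding smooth_on_def using Ck_on_cong by blast

lemma smooth_on_local:
  assumes "\<And>t. t \<in> S \<Longrightarrow> \<exists>U. t \<in> U \<and> smooth_on U f"
  shows "smooth_on S f"
  unfolding smooth_on_def
proof
  fix n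
  have "Ck_on n {t} f" if "t \<in> S" for t
    using assms[OF that] Ck_on_subset[of n _ f "{t}"] by (auto simp: smooth_on_def)
  then show "Ck_on n S f"
    using Ck_on_pointwise by blast
qed

section \<open>Closure of the differentiability classes under algebra, composition and
  inversion\<close>

lemma Ck_on_const: "Ck_on n S (\<lambda>_. c)"
proof (induction n arbitrary: c)
  case (Suc n)
  then show ?case by simp
qed auto

lemma Ck_on_ident: "open S \<Longrightarrow> Ck_on n S (\<lambda>t. t)"
proof (cases n)
  case (Suc m)
  assume "open S"
  then show ?thesis
    unfolding Suc by (intro Ck_on_SucI[of S _ "\<lambda>_. 1"] Ck_on_const) (auto simp: has_vector_derivative_id)
qed auto

lemma Ck_on_add:
  assumes "open S" "Ck_on n S f" "Ck_on n S g"
  shows "Ck_on n S (\<lambda>t. f t + g t)"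
  using assms(2,3)
proof (induction n arbitrary: f g)
  case (Suc n)
  show ?case
  proof (rule Ck_on_SucI[OF assms(1)])
    show "((\<lambda>t. f t + g t) has_vector_derivative
        vector_derivative f (at t) + vector_derivative g (at t)) (at t)" if "t \<in> S" for t
      using that Suc.prems by (intro has_vector_derivative_add Ck_on_SucD)
  qed (use Suc in auto)
qed auto

text \<open>One induction serves every product that occurs: real and complex multiplication, and the
  scalar multiplication in the chain rule.\<close>

lemma Ck_on_bilinear:
  assumes "bounded_bilinear b" "open S" "Ck_on n S f" "Ck_on n S g"
  shows "Ck_on n S (\<lambda>t. b (f t) (g t))"
  using assms(3,4)
proof (induction n arbitrary: f g)
  case 0
  then show ?case
    using bounded_bilinear.continuous[OF assms(1)] by fastforce
next
  case (Suc n)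
  show ?case
  proof (rule Ck_on_SucI[OF assms(2)])
    show "((\<lambda>t. b (f t) (g t)) has_vector_derivative
        b (f t) (vector_derivative g (at t)) + b (vector_derivative f (at t)) (g t)) (at t)" if "t \<in> S" for t
      using that Suc.prems by (intro bounded_bilinear.has_vector_derivative[OF assms(1)] Ck_on_SucD)
    show "Ck_on n S (\<lambda>t. b (f t) (vector_derivative g (at t)) + b (vector_derivative f (at t)) (g t))"
      using Suc.prems Suc.prems[THEN Ck_on_Suc_lower] by (intro Ck_on_add assms(2) Suc.IH) auto
  qed
qed

lemma Ck_on_linear:
  assumes "bounded_linear b" "open S" "Ck_on n S f"
  shows "Ck_on n S (\<lambda>t. b (f t))"
  using assms(3)
proof (induction n arbitrary: f)
  case 0
  then show ?case
    using bounded_linear.continuous[OF assms(1)] by fastforce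
next
  case (Suc n)
  show ?case
  proof (rule Ck_on_SucI[OF assms(2)])
    show "((\<lambda>t. b (f t)) has_vector_derivative b (vector_derivative f (at t))) (at t)" if "t \<in> S" for t
      using that Suc.prems by (intro bounded_linear.has_vector_derivative[OF assms(1)] Ck_on_SucD)
  qed (use Suc in auto)
qed

text \<open>The induction keeps \<open>f\<close> fixed and varies \<open>g\<close>: the chain rule
  yields the factor \<open>f'\<close>, which is of class n by assumption, and the composite of
  \<open>g'\<close> with \<open>f\<close>, which is an instance of the induction hypothesis.\<close>

lemma Ck_on_compose:
  fixes g :: "real \<Rightarrow> 'a::real_normed_vector"
  assumes "open S" "open T" "f ` S \<subseteq> T" "Ck_on n S f" "Ck_on n T g"
  shows "Ck_on n S (\<lambda>t. g (f t))"
  using assms(4,5)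
proof (induction n arbitrary: g)
  case 0
  then show ?case
    using assms(3) isCont_o2[of _ f g] by (simp add: image_subset_iff)
next
  case (Suc n)
  show ?case
  proof (rule Ck_on_SucI[OF assms(1)])
    fix t assume t: "t \<in> S"
    then have "f t \<in> T" using assms(3) by auto
    then show "((\<lambda>t. g (f t)) has_vector_derivative
        vector_derivative f (at t) *\<^sub>R vector_derivative g (at (f t))) (at t)"
      using vector_diff_chain_at[OF Ck_on_SucD[OF Suc.prems(1) t] Ck_on_SucD[OF Suc.prems(2)]]
      by (simp add: o_def)
  next
    show "Ck_on n S (\<lambda>t. vector_derivative f (at t) *\<^sub>R vector_derivative g (at (f t)))"
      using Suc.prems Ck_on_Suc_lower[OF Suc.prems(1)]
      by (intro Ck_on_bilinear[OF bounded_bilinear_scaleR assms(1)] Suc.IH) auto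
  qed
qed

lemma smooth_on_const: "smooth_on S (\<lambda>_. c)"
  and smooth_on_ident: "open S \<Longrightarrow> smooth_on S (\<lambda>t. t)"
  and smooth_on_add: "open S \<Longrightarrow> smooth_on S f \<Longrightarrow> smooth_on S g \<Longrightarrow> smooth_on S (\<lambda>t. f t + g t)"
  and smooth_on_linear: "bounded_linear b \<Longrightarrow> open S \<Longrightarrow> smooth_on S h \<Longrightarrow> smooth_on S (\<lambda>t. b (h t))"
  by (simp_all add: smooth_on_def Ck_on_const Ck_on_ident Ck_on_add Ck_on_linear)

lemma smooth_on_diff_const: "open S \<Longrightarrow> smooth_on S f \<Longrightarrow> smooth_on S (\<lambda>t. f t - c)"
  using smooth_on_add[OF _ _ smooth_on_const[of S "- c"], of f] by simp

lemma smooth_on_mult: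
  fixes f g :: "real \<Rightarrow> 'a::real_normed_algebra"
  shows "open S \<Longrightarrow> smooth_on S f \<Longrightarrow> smooth_on S g \<Longrightarrow> smooth_on S (\<lambda>t. f t * g t)"
  by (simp add: smooth_on_def Ck_on_bilinear[OF bounded_bilinear_mult])

lemma smooth_on_compose:
  assumes "smooth_on T g" "open T" "open S" "smooth_on S f" "\<And>t. t \<in> S \<Longrightarrow> f t \<in> T"
  shows "smooth_on S (\<lambda>t. g (f t))"
  unfolding smooth_on_def
proof
  fix n show "Ck_on n S (\<lambda>t. g (f t))"
    by (rule Ck_on_compose[OF assms(3,2)]) (use assms(1,4,5) in \<open>auto simp: smooth_on_def\<close>)
qed

lemma smooth_on_powr: "smooth_on {0<..} (\<lambda>t::real. t powr a)"
  unfolding smooth_on_def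
proof
  fix n show "Ck_on n {0<..} (\<lambda>t::real. t powr a)"
  proof (induction n arbitrary: a)
    case 0
    then show ?case by (auto intro!: continuous_at_within_powr continuous_ident continuous_const)
  next
    case (Suc n)
    show ?case
    proof (rule Ck_on_SucI)
      show "((\<lambda>t. t powr a) has_vector_derivative a * t powr (a - 1)) (at t)" if "t \<in> {0<..}" for t
        unfolding has_real_derivative_iff_has_vector_derivative[symmetric]
        using that by (auto intro!: derivative_eq_intros)
    qed (auto intro: Ck_on_bilinear[OF bounded_bilinear_mult _ Ck_on_const Suc])
  qed
qed

lemma smooth_on_inverse:
  assumes "open S" "smooth_on S f" "\<And>t. t \<in> S \<Longrightarrow> f t > 0"
  shows "smooth_on S (\<lambda>t. inverse (f t :: real))"
proof -
  have "smooth_on S (\<lambda>t. f t powr (-1))"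
    by (rule smooth_on_compose[OF smooth_on_powr]) (use assms in auto)
  then show ?thesis
    by (rule smooth_on_cong) (use assms in \<open>auto simp: powr_minus less_le\<close>)
qed

lemma smooth_on_exp: "smooth_on UNIV (\<lambda>t. exp (c * of_real t) :: complex)"
  unfolding smooth_on_def
proof
  fix n show "Ck_on n UNIV (\<lambda>t. exp (c * of_real t) :: complex)"
  proof (induction n)
    case 0
    then show ?case by simp
  next
    case (Suc n)
    show ?case
    proof (rule Ck_on_SucI)
      show "((\<lambda>t. exp (c * of_real t)) has_vector_derivative c * exp (c * of_real t)) (at t)" for t
        by (rule has_vector_derivative_real_field) (auto intro!: derivative_eq_intros)
    qed (auto intro: Ck_on_bilinear[OF bounded_bilinear_mult _ Ck_on_const Suc])
  qed
qed

section \<open>Iterated derivatives and the smoothness predicate\<close>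

lemma nderiv_Suc: "nderiv (Suc n) f = nderiv n (\<lambda>t. vector_derivative f (at t))"
  unfolding nderiv_def by (simp add: funpow_Suc_right del: funpow.simps)

lemma nderiv_0: "nderiv 0 f = f"
  by (simp add: nderiv_def)

lemma differentiable_on_UNIV: "f differentiable_on UNIV \<longleftrightarrow> (\<forall>t. f differentiable at t)"
  by (simp add: differentiable_on_def)

text \<open>Links the notion of smoothness in the definitions to the recursive one. Both inductions
  peel off the innermost derivative, as in \<open>nderiv_Suc\<close>, since \<open>Ck_on\<close>
  recurses in that order.\<close>

lemma smooth_on_UNIV_iff: "smooth_on UNIV f \<longleftrightarrow> (\<forall>n. nderiv n f differentiable_on UNIV)"
proof
  assume "smooth_on UNIV f"
  then show "\<forall>n. nderiv n f differentiable_on UNIV"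
    unfolding differentiable_on_UNIV
  proof (intro allI)
    fix n t assume "smooth_on UNIV f"
    then show "nderiv n f differentiable at t"
    proof (induction n arbitrary: f)
      case 0
      then show ?case
        using smooth_on_has_vector_derivative differentiableI_vector by (fastforce simp: nderiv_0)
    next
      case (Suc n)
      then show ?case by (simp add: nderiv_Suc smooth_on_deriv)
    qed
  qed
next
  assume *: "\<forall>n. nderiv n f differentiable_on UNIV"
  have "Ck_on n UNIV f" for n
    using *
  proof (induction n arbitrary: f)
    case 0
    from spec[OF 0, of 0] show ?case
      by (auto simp: nderiv_0 differentiable_on_UNIV differentiable_imp_continuous_within)
  next
    case (Suc n)
    have "Ck_on n UNIV (\<lambda>t. vector_derivative f (at t))"
      by (rule Suc.IH) (use Suc.prems nderiv_Suc in metis)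
    moreover from spec[OF Suc.prems, of 0] have "\<forall>t. f differentiable at t"
      by (simp add: nderiv_0 differentiable_on_UNIV)
    ultimately show ?case by simp
  qed
  then show "smooth_on UNIV f" by (simp add: smooth_on_def)
qed

lemma smooth_on_circle_iff: "smooth_on_circle f \<longleftrightarrow> (\<forall>t. f (t + 2 * pi) = f t) \<and> smooth_on UNIV f"
  by (simp add: smooth_on_circle_def smooth_on_UNIV_iff)

text \<open>Continuity of \<open>v\<close> gives the derivative of the inverse at each point. The
  formula \<open>v' = 1 / u'(v)\<close> then bootstraps: if \<open>v\<close> is of class n, so is
  the right-hand side, hence \<open>v\<close> is of class n + 1.\<close>

lemma smooth_on_inverse_function:
  fixes u v :: "real \<Rightarrow> real"
  assumes "open T" "open S" "smooth_on S u" "\<And>s. s \<in> T \<Longrightarrow> v s \<in> S" "\<And>s. s \<in> T \<Longrightarrow> u (v s) = s"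
    and "continuous_on T v" "\<And>t. t \<in> S \<Longrightarrow> vector_derivative u (at t) > 0"
  shows "smooth_on T v"
    and "\<And>s. s \<in> T \<Longrightarrow> (v has_vector_derivative inverse (vector_derivative u (at (v s)))) (at s)"
proof -
  show d: "(v has_vector_derivative inverse (vector_derivative u (at (v s)))) (at s)" if "s \<in> T" for s
  proof -
    obtain e where e: "e > 0" "ball s e \<subseteq> T"
      using assms(1) \<open>s \<in> T\<close> by (meson openE)
    have "(u has_field_derivative vector_derivative u (at (v s))) (at (v s))"
      unfolding has_real_derivative_iff_has_vector_derivative
      by (rule smooth_on_has_vector_derivative[OF assms(3) assms(4)[OF that]])
    then show ?thesis
      unfolding has_real_derivative_iff_has_vector_derivative[symmetric]
    proof (rule DERIV_inverse_function)
      show "s - e < s" "s < s + e" using e by auto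
      show "u (v y) = y" if "s - e < y" "y < s + e" for y
        using assms(5)[of y] e that
        by (auto simp: dist_real_def subset_iff abs_less_iff)
      show "isCont v s"
        using assms(1,6) that continuous_on_eq_continuous_at by blast
      show "vector_derivative u (at (v s)) \<noteq> 0"
        using assms(7)[OF assms(4)[OF that]] by simp
    qed
  qed
  have "Ck_on n T v" for n
  proof (induction n)
    case 0
    then show ?case using assms(1,6) continuous_on_eq_continuous_at by auto
  next
    case (Suc n)
    have "Ck_on n S (\<lambda>t. inverse (vector_derivative u (at t)))"
      using smooth_on_inverse[OF assms(2) smooth_on_deriv[OF assms(3)]] assms(7)
      by (simp add: smooth_on_def)
    then have "Ck_on n T (\<lambda>s. inverse (vector_derivative u (at (v s))))"
      by (intro Ck_on_compose[OF assms(1,2) _ Suc]) (use assms(4) in auto)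
    with d show ?case by (intro Ck_on_SucI[OF assms(1)])
  qed
  then show "smooth_on T v" by (simp add: smooth_on_def)
qed

section \<open>Bump functions\<close>

lemma tendsto_poly_div_exp_0: "((\<lambda>z::real. poly q z / exp z) \<longlongrightarrow> 0) at_top"
proof -
  have "((\<lambda>z::real. \<Sum>i\<le>degree q. coeff q i * (z ^ i / exp z)) \<longlongrightarrow> (\<Sum>i\<le>degree q. coeff q i * 0)) at_top"
    by (intro tendsto_sum tendsto_mult tendsto_const tendsto_power_div_exp_0)
  then show ?thesis
    by (simp add: poly_altdef sum_divide_distrib)
qed

text \<open>The functions \<open>q(1/t) e\<^sup>-\<^sup>1\<^sup>/\<^sup>t\<close> with \<open>q\<close> a polynomial, extended by \<open>0\<close>, are closed under
  differentiation.\<close>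

definition flat_exp :: "real poly \<Rightarrow> real \<Rightarrow> real" where
  "flat_exp q t = (if t > 0 then poly q (1 / t) * exp (- (1 / t)) else 0)"

text \<open>The polynomial \<open>[:0, 0, 1:]\<close> is the square of the variable: it is the
  \<open>1 / t^2\<close> from differentiating \<open>- 1 / t\<close>. The exponential contributes
  \<open>q\<close> and the polynomial factor contributes \<open>- pderiv q\<close>.\<close>

lemma flat_exp_has_vector_derivative:
  "(flat_exp q has_vector_derivative flat_exp ([:0, 0, 1:] * (q - pderiv q)) t) (at t)"
proof -
  consider "t > 0" | "t < 0" | "t = 0" by linarith
  then show ?thesis
  proof cases
    case 1
    have "((\<lambda>t. poly q (1 / t) * exp (- (1 / t))) has_real_derivative
        flat_exp ([:0, 0, 1:] * (q - pderiv q)) t) (at t)"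
      using 1 by (auto intro!: derivative_eq_intros poly_DERIV[THEN DERIV_chain2]
          simp: flat_exp_def power2_eq_square field_simps)
    then show ?thesis
      unfolding has_real_derivative_iff_has_vector_derivative
      by (rule has_vector_derivative_transform_within_open[where S = "{0<..}"])
        (use 1 in \<open>auto simp: flat_exp_def\<close>)
  next
    case 2
    have "((\<lambda>_. 0) has_vector_derivative flat_exp ([:0, 0, 1:] * (q - pderiv q)) t) (at t)"
      using 2 by (simp add: flat_exp_def)
    then show ?thesis
      by (rule has_vector_derivative_transform_within_open[where S = "{..<0}"])
        (use 2 in \<open>auto simp: flat_exp_def\<close>)
  next
    case 3
    have "((\<lambda>h. flat_exp q h / h) \<longlongrightarrow> 0) (at_right 0)"
    proof -
      \<comment> \<open>With \<open>z = 1 / h\<close> the difference quotient at the origin becomes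
        \<open>z * q(z) / exp z\<close>, which is again a polynomial over the exponential; the
        factor \<open>[:0, 1:]\<close> is the \<open>1 / h\<close> of the quotient.\<close>
      have "((\<lambda>h. poly ([:0, 1:] * q) (inverse h) / exp (inverse h)) \<longlongrightarrow> 0) (at_right (0::real))"
        by (rule filterlim_compose[OF tendsto_poly_div_exp_0 filterlim_inverse_at_top_right])
      moreover have "\<forall>\<^sub>F h in at_right (0::real).
          poly ([:0, 1:] * q) (inverse h) / exp (inverse h) = flat_exp q h / h"
        unfolding eventually_at_right_field
        by (intro exI[of _ 1]) (auto simp: flat_exp_def exp_minus field_simps)
      ultimately show ?thesis
        using tendsto_cong by fast
    qed
    moreover have "((\<lambda>h. flat_exp q h / h) \<longlongrightarrow> 0) (at_left 0)"
    proof -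
      have "\<forall>\<^sub>F h in at_left (0::real). 0 = flat_exp q h / h"
        unfolding eventually_at_left_field
        by (intro exI[of _ "-1"]) (auto simp: flat_exp_def)
      then show ?thesis
        using tendsto_cong tendsto_const by fast
    qed
    ultimately have "((\<lambda>h. flat_exp q h / h) \<longlongrightarrow> 0) (at 0)"
      by (simp add: filterlim_at_split)
    then show ?thesis
      unfolding 3 has_real_derivative_iff_has_vector_derivative[symmetric] DERIV_def
      by (simp add: flat_exp_def)
  qed
qed

lemma smooth_on_flat_exp: "smooth_on UNIV (flat_exp q)"
  unfolding smooth_on_def
proof
  fix n show "Ck_on n UNIV (flat_exp q)"
  proof (induction n arbitrary: q)
    case 0
    then show ?case
      using has_vector_derivative_continuous[OF flat_exp_has_vector_derivative] by simp
  next
    case (Suc n)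
    then show ?case
      by (intro Ck_on_SucI[OF _ flat_exp_has_vector_derivative]) auto
  qed
qed

lemma exists_smooth_bump:
  assumes "r > 0"
  shows "\<exists>b :: real \<Rightarrow> real. smooth_on UNIV b \<and> b 0 = 1 \<and> (\<forall>s. \<bar>s\<bar> \<ge> r \<longrightarrow> b s = 0)"
proof (intro exI conjI allI impI)
  \<comment> \<open>Inside the interval this is \<open>exp (1/r^2 - 1/(r^2 - s^2))\<close>; the
    prefactor normalises the value at 0 to 1.\<close>
  let ?b = "\<lambda>s. exp (1 / r\<^sup>2) * flat_exp 1 (r\<^sup>2 + (- 1) * (s * s))"
  show "smooth_on UNIV ?b"
    by (intro smooth_on_mult smooth_on_const smooth_on_compose[OF smooth_on_flat_exp]
        smooth_on_add smooth_on_ident) auto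
  show "?b 0 = 1"
    using assms by (simp add: flat_exp_def exp_minus)
  show "?b s = 0" if "\<bar>s\<bar> \<ge> r" for s
  proof -
    have "r\<^sup>2 \<le> s\<^sup>2" using that assms by (simp add: abs_le_square_iff[symmetric])
    then show ?thesis by (simp add: flat_exp_def power2_eq_square)
  qed
qed

section \<open>Division by powers\<close>

text \<open>Differentiation under the integral sign brings down one factor \<open>s\<close>, so the
  weight \<open>s ^ k\<close> has to be general for the induction to close.\<close>

lemma Ck_on_integral_segment:
  fixes f :: "real \<Rightarrow> real"
  assumes "Ck_on n UNIV f"
  shows "Ck_on n UNIV (\<lambda>y. integral {0..1} (\<lambda>s. s ^ k * f (c + s * (y - c))))"
  using assms
proof (induction n arbitrary: f k)
  case 0
  then have f: "continuous_on UNIV f"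
    by (simp add: continuous_at_imp_continuous_on)
  have "continuous_on UNIV (\<lambda>y. integral (cbox 0 1) (\<lambda>s. s ^ k * f (c + s * (y - c))))"
    by (rule integral_continuous_on_param)
      (auto intro!: continuous_intros continuous_on_compose2[OF f] simp: split_beta)
  then show ?case
    by (simp add: continuous_on_eq_continuous_at)
next
  case (Suc n)
  let ?f' = "\<lambda>t. vector_derivative f (at t)"
  have f': "continuous_on UNIV ?f'" and f: "continuous_on UNIV f"
    using Ck_on_imp_isCont[OF Suc.prems] Ck_on_imp_isCont[of n UNIV ?f'] Suc.prems
    by (simp_all add: continuous_at_imp_continuous_on)
  show ?case
  proof (rule Ck_on_SucI)
    fix y
    have "((\<lambda>y. integral (cbox 0 1) (\<lambda>s. s ^ k * f (c + s * (y - c)))) has_vector_derivative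
        integral (cbox 0 1) (\<lambda>s. s ^ Suc k * ?f' (c + s * (y - c)))) (at y within UNIV)"
    proof (rule leibniz_rule_vector_derivative)
      show "((\<lambda>y. s ^ k * f (c + s * (y - c))) has_vector_derivative
          s ^ Suc k * ?f' (c + s * (y - c))) (at y within UNIV)" for y s
      proof -
        have "(f has_real_derivative ?f' (c + s * (y - c))) (at (c + s * (y - c)))"
          using Ck_on_SucD[OF Suc.prems] by (simp add: has_real_derivative_iff_has_vector_derivative)
        then have "((\<lambda>y. s ^ k * f (c + s * (y - c))) has_real_derivative
            s ^ Suc k * ?f' (c + s * (y - c))) (at y)"
          by (auto intro!: derivative_eq_intros DERIV_chain2[where f = f] simp: algebra_simps)
        then show ?thesis
          by (simp add: has_real_derivative_iff_has_vector_derivative)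
      qed
      show "(\<lambda>s. s ^ k * f (c + s * (y - c))) integrable_on cbox 0 1" for y
        by (intro integrable_continuous continuous_intros continuous_on_compose2[OF f]) auto
      show "continuous_on (UNIV \<times> cbox 0 1) (\<lambda>(y, s). s ^ Suc k * ?f' (c + s * (y - c)))"
        by (auto intro!: continuous_intros continuous_on_compose2[OF f'] simp: split_beta)
    qed auto
    then show "((\<lambda>y. integral {0..1} (\<lambda>s. s ^ k * f (c + s * (y - c)))) has_vector_derivative
        integral {0..1} (\<lambda>s. s ^ Suc k * ?f' (c + s * (y - c)))) (at y)"
      by simp
  next
    show "Ck_on n UNIV (\<lambda>y. integral {0..1} (\<lambda>s. s ^ Suc k * ?f' (c + s * (y - c))))"
      by (rule Suc.IH) (use Suc.prems in simp)
  qed simp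
qed

lemma smooth_on_integral_segment:
  fixes f :: "real \<Rightarrow> real"
  shows "smooth_on UNIV f \<Longrightarrow>
    smooth_on UNIV (\<lambda>y. integral {0..1} (\<lambda>s. s ^ k * f (c + s * (y - c))))"
  by (simp add: smooth_on_def Ck_on_integral_segment)

text \<open>Hadamard's form of the fundamental theorem of calculus. Integrating over the parameter
  in [0, 1] covers \<open>y < c\<close> and \<open>y > c\<close> at once.\<close>

lemma integral_segment:
  fixes f :: "real \<Rightarrow> real"
  assumes "smooth_on UNIV f"
  shows "f y = f c + (y - c) * integral {0..1} (\<lambda>s. vector_derivative f (at (c + s * (y - c))))"
proof -
  let ?f' = "\<lambda>t. vector_derivative f (at t)"
  have "((\<lambda>s. (y - c) * ?f' (c + s * (y - c))) has_integral
      f (c + 1 * (y - c)) - f (c + 0 * (y - c))) {0..1}"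
  proof (rule fundamental_theorem_of_calculus)
    fix s :: real
    have "(f has_real_derivative ?f' (c + s * (y - c))) (at (c + s * (y - c)))"
      using smooth_on_has_vector_derivative[OF assms]
      by (simp add: has_real_derivative_iff_has_vector_derivative)
    then have "((\<lambda>s. f (c + s * (y - c))) has_real_derivative (y - c) * ?f' (c + s * (y - c))) (at s)"
      by (subst mult.commute, elim DERIV_chain2) (auto intro!: derivative_eq_intros)
    then show "((\<lambda>s. f (c + s * (y - c))) has_vector_derivative (y - c) * ?f' (c + s * (y - c)))
        (at s within {0..1})"
      by (simp add: has_real_derivative_iff_has_vector_derivative has_vector_derivative_at_within)
  qed simp
  from integral_unique[OF this] show ?thesis by simp
qed

text \<open>The induction passes to \<open>f'\<close>: its factorisation is integrated along the
  segment from \<open>c\<close> to \<open>y\<close>, where the power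
  \<open>(s * (y - c)) ^ Suc p\<close> splits into a factor outside the integral and a weight inside
  it. The integral of that weight over [0, 1] is \<open>1 / (p + 2)\<close>, which advances the
  factorial in the value at \<open>c\<close>.\<close>

lemma taylor_factor:
  fixes f :: "real \<Rightarrow> real"
  assumes "smooth_on UNIV f" "\<And>k. 1 \<le> k \<Longrightarrow> k \<le> p \<Longrightarrow> nderiv k f c = 0"
  shows "\<exists>h. smooth_on UNIV h \<and> (\<forall>y. f y = f c + (y - c) ^ Suc p * h y) \<and>
    h c = nderiv (Suc p) f c / fact (Suc p)"
  using assms
proof (induction p arbitrary: f)
  case 0
  let ?f' = "\<lambda>t. vector_derivative f (at t)"
  show ?case
  proof (intro exI conjI allI)
    show "smooth_on UNIV (\<lambda>y. integral {0..1} (\<lambda>s. ?f' (c + s * (y - c))))"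
      using smooth_on_integral_segment[OF smooth_on_deriv[OF 0(1)], of 0 c] by simp
    show "f y = f c + (y - c) ^ Suc 0 * integral {0..1} (\<lambda>s. ?f' (c + s * (y - c)))" for y
      unfolding power_Suc power_0 mult_1_right by (rule integral_segment[OF 0(1)])
  qed (simp add: nderiv_Suc nderiv_0)
next
  case (Suc p)
  let ?f' = "\<lambda>t. vector_derivative f (at t)"
  have "\<exists>h. smooth_on UNIV h \<and> (\<forall>y. ?f' y = ?f' c + (y - c) ^ Suc p * h y) \<and>
      h c = nderiv (Suc p) ?f' c / fact (Suc p)"
  proof (rule Suc.IH)
    show "nderiv k ?f' c = 0" if "1 \<le> k" "k \<le> p" for k
      using Suc.prems(2)[of "Suc k"] that by (simp add: nderiv_Suc)
  qed (rule smooth_on_deriv[OF Suc.prems(1)])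
  then obtain h where h: "smooth_on UNIV h" "\<And>y. ?f' y = ?f' c + (y - c) ^ Suc p * h y"
      "h c = nderiv (Suc p) ?f' c / fact (Suc p)"
    by blast
  have "?f' c = 0"
    using Suc.prems(2)[of 1] by (simp add: nderiv_Suc nderiv_0)
  with h(2) have f': "?f' y = (y - c) ^ Suc p * h y" for y
    by simp
  let ?h = "\<lambda>y. integral {0..1} (\<lambda>s. s ^ Suc p * h (c + s * (y - c)))"
  have "f y = f c + (y - c) ^ Suc (Suc p) * ?h y" for y
  proof -
    have "f y = f c + (y - c) * integral {0..1} (\<lambda>s. ?f' (c + s * (y - c)))"
      by (rule integral_segment[OF Suc.prems(1)])
    also have "integral {0..1} (\<lambda>s. ?f' (c + s * (y - c))) =
        integral {0..1} (\<lambda>s. (y - c) ^ Suc p * (s ^ Suc p * h (c + s * (y - c))))"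
      unfolding f' by (simp add: power_mult_distrib mult_ac)
    finally show ?thesis by (simp add: mult.assoc)
  qed
  moreover have "?h c = nderiv (Suc (Suc p)) f c / fact (Suc (Suc p))"
  proof -
    have "((\<lambda>s. s ^ Suc p) has_integral (1 ^ Suc (Suc p) / Suc (Suc p) - 0 ^ Suc (Suc p) / Suc (Suc p))) {0..1::real}"
    proof (rule fundamental_theorem_of_calculus)
      fix x :: real
      have "((\<lambda>s. s ^ Suc (Suc p) / Suc (Suc p)) has_real_derivative x ^ Suc p) (at x within {0..1})"
        by (auto intro!: derivative_eq_intros simp del: power_Suc of_nat_Suc)
      then show "((\<lambda>s. s ^ Suc (Suc p) / Suc (Suc p)) has_vector_derivative x ^ Suc p) (at x within {0..1})"
        by (simp add: has_real_derivative_iff_has_vector_derivative)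
    qed simp
    then have "integral {0..1} (\<lambda>s::real. s ^ Suc p) = 1 / real (Suc (Suc p))"
      by (simp add: integral_unique)
    then have "?h c = h c / real (Suc (Suc p))"
      by simp
    also have "\<dots> = nderiv (Suc (Suc p)) f c / fact (Suc (Suc p))"
      unfolding h(3) nderiv_Suc[of "Suc p" f] by (simp add: field_simps)
    finally show ?thesis .
  qed
  ultimately show ?case
    using smooth_on_integral_segment[OF h(1), of "Suc p" c] by blast
qed


section \<open>Normal form near a stationary point\<close>

text \<open>Here \<open>u\<close> is the coordinate and \<open>v\<close> its inverse, the
  parametrisation by \<open>s\<close>; both are recorded because transport composes one with the
  other. The bound by \<open>pi\<close> makes the image embed in the circle, so that
  \<open>circle_rep c\<close> selects the right representative.\<close>

definition normal_chart ::
  "(real \<Rightarrow> real) \<Rightarrow> nat \<Rightarrow> real \<Rightarrow> real \<Rightarrow> real \<Rightarrow> (real \<Rightarrow> real) \<Rightarrow> (real \<Rightarrow> real) \<Rightarrow> bool" where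
  "normal_chart R p \<epsilon> c r u v \<longleftrightarrow>
     r > 0 \<and> smooth_on {-r<..<r} v \<and> open (v ` {-r<..<r}) \<and> smooth_on (v ` {-r<..<r}) u \<and> v 0 = c \<and>
     (\<forall>s\<in>{-r<..<r}. u (v s) = s \<and> vector_derivative v (at s) > 0 \<and> \<bar>v s - c\<bar> < pi \<and>
        R (v s) = R c + \<epsilon> * s ^ p)"

text \<open>Two charts are matched by equating their coordinates, which requires a common
  radius.\<close>

lemma normal_chart_shrink:
  assumes "normal_chart R p \<epsilon> c r u v" "0 < r'" "r' \<le> r"
  shows "normal_chart R p \<epsilon> c r' u v"
proof -
  have sub: "{-r'<..<r'} \<subseteq> {-r<..<r}" using assms by auto
  let ?J = "v ` {-r<..<r}"
  have u: "\<And>s. s \<in> {-r<..<r} \<Longrightarrow> u (v s) = s" and J: "open ?J" "smooth_on ?J u"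
    using assms(1) by (auto simp: normal_chart_def)
  have "v ` {-r'<..<r'} = ?J \<inter> u -` {-r'<..<r'}"
  proof (intro equalityI subsetI)
    fix y assume "y \<in> v ` {-r'<..<r'}"
    then obtain s where "s \<in> {-r'<..<r'}" "y = v s" by blast
    then show "y \<in> ?J \<inter> u -` {-r'<..<r'}" using sub u[of s] by blast
  next
    fix y assume "y \<in> ?J \<inter> u -` {-r'<..<r'}"
    then obtain s where "s \<in> {-r<..<r}" "y = v s" "u y \<in> {-r'<..<r'}" by blast
    then show "y \<in> v ` {-r'<..<r'}" using u[of s] by auto
  qed
  then have "open (v ` {-r'<..<r'})"
    using continuous_open_preimage[OF smooth_on_continuous_on[OF J(2)] J(1)] by simp
  moreover have "smooth_on (v ` {-r'<..<r'}) u" "smooth_on {-r'<..<r'} v"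
    using assms(1) sub by (auto simp: normal_chart_def intro!: smooth_on_subset[of ?J u] smooth_on_subset[of "{-r<..<r}" v])
  ultimately show ?thesis
    using assms sub unfolding normal_chart_def by blast
qed

text \<open>The Taylor factorisation turns \<open>R - R c\<close> into
  \<open>(y - c) ^ p * h\<close>. Only the factor \<open>\<epsilon> * h\<close>, positive near
  \<open>c\<close>, is put under the p-th root. Keeping \<open>y - c\<close> outside makes
  \<open>u\<close> smooth through \<open>c\<close>, and for even \<open>p\<close> it is also what
  makes \<open>u\<close> change sign there.\<close>

lemma smooth_root:
  fixes R :: "real \<Rightarrow> real"
  assumes R: "smooth_on UNIV R" and p: "p \<ge> 1"
    and flat: "\<And>k. 1 \<le> k \<Longrightarrow> k < p \<Longrightarrow> nderiv k R c = 0"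
    and sgn: "sgn (nderiv p R c) = \<epsilon>" and \<epsilon>: "\<epsilon> \<in> {1, -1}"
  obtains U u where "open U" "c \<in> U" "smooth_on U u" "u c = 0" "vector_derivative u (at c) > 0"
    "\<And>y. y \<in> U \<Longrightarrow> R y = R c + \<epsilon> * u y ^ p"
proof -
  \<comment> \<open>The factorisation lemma is indexed by the number of vanishing derivatives, which
    is one less than the order.\<close>
  obtain q where q: "p = Suc q" using p by (cases p) auto
  have "\<exists>h. smooth_on UNIV h \<and> (\<forall>y. R y = R c + (y - c) ^ p * h y) \<and> h c = nderiv p R c / fact p"
    unfolding q by (rule taylor_factor[OF R]) (use flat q in auto)
  then obtain h where h: "smooth_on UNIV h" "\<And>y. R y = R c + (y - c) ^ p * h y"
      "h c = nderiv p R c / fact p"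
    by blast
  define U where "U = {y. \<epsilon> * h y > 0}"
  define w where "w = (\<lambda>y. (\<epsilon> * h y) powr (1 / real p))"
  have cont: "continuous_on UNIV (\<lambda>y. \<epsilon> * h y)"
    by (intro continuous_intros smooth_on_continuous_on h)
  have U: "open U"
    unfolding U_def by (intro open_Collect_less cont continuous_intros)
  \<comment> \<open>Since \<open>\<epsilon>\<close> is the sign of \<open>nderiv p R c\<close>, the
    number \<open>\<epsilon> * h c\<close> is its absolute value divided by
    \<open>fact p\<close>.\<close>
  have "c \<in> U"
    using \<epsilon> sgn by (auto simp: U_def h(3) sgn_if zero_less_mult_iff mult_less_0_iff zero_less_divide_iff
        divide_less_0_iff split: if_splits)
  have w: "smooth_on U w"
    unfolding w_def
    by (rule smooth_on_compose[OF smooth_on_powr _ U])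
      (auto simp: U_def[symmetric] intro!: smooth_on_mult U smooth_on_const smooth_on_subset[OF h(1)],
        simp add: U_def)
  have wp: "w y ^ p = \<epsilon> * h y" if "y \<in> U" for y
    using that p by (subst powr_realpow[symmetric]) (auto simp: w_def U_def powr_powr)
  define u where "u = (\<lambda>y. (y - c) * w y)"
  have u: "smooth_on U u"
    unfolding u_def by (intro smooth_on_mult smooth_on_diff_const smooth_on_ident U w)
  have "(w has_real_derivative vector_derivative w (at c)) (at c)"
    using smooth_on_has_vector_derivative[OF w \<open>c \<in> U\<close>]
    by (simp add: has_real_derivative_iff_has_vector_derivative)
  then have "(u has_real_derivative w c) (at c)"
    unfolding u_def by (auto intro!: derivative_eq_intros)
  then have "vector_derivative u (at c) = w c"
    by (intro vector_derivative_at) (simp add: has_real_derivative_iff_has_vector_derivative)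
  also have "\<dots> > 0"
    using \<open>c \<in> U\<close> by (auto simp: w_def U_def)
  finally have "vector_derivative u (at c) > 0" .
  moreover have "R y = R c + \<epsilon> * u y ^ p" if "y \<in> U" for y
  proof -
    have "\<epsilon> * u y ^ p = (y - c) ^ p * (\<epsilon> * \<epsilon> * h y)"
      using wp[OF that] by (simp add: u_def power_mult_distrib mult_ac)
    then show ?thesis using \<epsilon> h(2)[of y] by auto
  qed
  moreover have "u c = 0" by (simp add: u_def)
  ultimately show ?thesis
    using that U \<open>c \<in> U\<close> u by blast
qed

text \<open>The coordinate \<open>u\<close> is strictly increasing on a compact interval around
  \<open>c\<close>. The intermediate value theorem then supplies the domain of the inverse,
  compactness its continuity, and \<open>smooth_on_inverse_function\<close> its smoothness.\<close>

lemma exists_normal_chart: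
  fixes R :: "real \<Rightarrow> real"
  assumes "smooth_on UNIV R" "p \<ge> 1" "\<And>k. 1 \<le> k \<Longrightarrow> k < p \<Longrightarrow> nderiv k R c = 0"
    and "sgn (nderiv p R c) = \<epsilon>" "\<epsilon> \<in> {1, -1}"
  obtains r u v where "normal_chart R p \<epsilon> c r u v"
proof -
  obtain U u where U: "open U" "c \<in> U" "smooth_on U u" "u c = 0" "vector_derivative u (at c) > 0"
    and Ru: "\<And>y. y \<in> U \<Longrightarrow> R y = R c + \<epsilon> * u y ^ p"
    using smooth_root[of R p c \<epsilon>] assms by blast
  let ?u' = "\<lambda>y. vector_derivative u (at y)"
  let ?W = "U \<inter> ?u' -` {0<..}"
  have "open ?W"
    by (rule continuous_open_preimage[OF smooth_on_continuous_on[OF smooth_on_deriv[OF U(3)]] U(1)]) simp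
  moreover have "c \<in> ?W" using U by simp
  ultimately obtain e where e: "e > 0" "cball c e \<subseteq> ?W"
    using open_contains_cball by blast
  \<comment> \<open>The cap \<open>pi / 2\<close> is any number below \<open>pi\<close>: it yields
    the bound that lets the chart embed in the circle.\<close>
  define d where "d = min e (pi / 2)"
  have d: "d > 0" "d < pi" "{c - d..c + d} \<subseteq> ?W"
    using e by (auto simp: d_def min_def dist_real_def subset_iff abs_le_iff)
  let ?I = "{c - d..c + d}"
  have mono: "u x < u y" if "x \<in> ?I" "y \<in> ?I" "x < y" for x y
  proof (rule DERIV_pos_imp_increasing[OF that(3)])
    fix t assume "x \<le> t" "t \<le> y"
    then have "t \<in> ?I" using that by auto
    then have "t \<in> ?W" using d(3) by blast
    then show "\<exists>D. (u has_real_derivative D) (at t) \<and> D > 0"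
      using smooth_on_has_vector_derivative[OF U(3), of t]
      by (auto simp: has_real_derivative_iff_has_vector_derivative)
  qed
  define v where "v = the_inv_into ?I u"
  \<comment> \<open>The smaller of the two end values gives a symmetric interval inside the range of
    \<open>u\<close>. As \<open>r\<close> is excluded, \<open>v\<close> avoids the end points and
    lands in the open interval.\<close>
  define r where "r = min (u (c + d)) (- u (c - d))"
  have "u (c - d) < 0" "u (c + d) > 0"
    using mono[of "c - d" c] mono[of c "c + d"] d(1) U(4) by auto
  then have r: "r > 0" by (simp add: r_def)
  have inj: "inj_on u ?I"
    using mono by (intro linorder_inj_onI') force
  have u: "smooth_on ?I u"
    using U(3) d(3) smooth_on_subset by blast
  have surj: "{-r<..<r} \<subseteq> u ` ?I"
  proof
    fix s assume "s \<in> {-r<..<r}"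
    then have "\<exists>x\<ge>c - d. x \<le> c + d \<and> u x = s"
      using d(1) by (intro IVT' smooth_on_continuous_on u) (auto simp: r_def)
    then show "s \<in> u ` ?I" by auto
  qed
  have vI: "v s \<in> {c - d<..<c + d}" and uv: "u (v s) = s" if "s \<in> {-r<..<r}" for s
  proof -
    have "v s \<in> ?I"
      unfolding v_def using the_inv_into_into[OF inj, of s ?I] that surj by blast
    moreover show "u (v s) = s"
      unfolding v_def using f_the_inv_into_f[OF inj, of s] that surj by blast
    then have "v s \<noteq> c - d" "v s \<noteq> c + d"
      using that by (auto simp: r_def)
    ultimately show "v s \<in> {c - d<..<c + d}" by auto
  qed
  have vu: "v (u y) = y" if "y \<in> ?I" for y
    unfolding v_def by (rule the_inv_into_f_f[OF inj that])
  have contv: "continuous_on {-r<..<r} v"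
    using continuous_on_inv[OF smooth_on_continuous_on[OF u] compact_Icc, of v] vu surj
      continuous_on_subset by blast
  have sub: "{c - d<..<c + d} \<subseteq> ?W" using d(3) by (auto simp: subset_iff)
  have ug: "smooth_on {c - d<..<c + d} u" using smooth_on_subset[OF U(3)] sub by blast
  have pos: "?u' t > 0" if "t \<in> {c - d<..<c + d}" for t using sub that by blast
  have v: "smooth_on {-r<..<r} v"
    and v': "\<And>s. s \<in> {-r<..<r} \<Longrightarrow> (v has_vector_derivative inverse (?u' (v s))) (at s)"
    using smooth_on_inverse_function[OF open_greaterThanLessThan open_greaterThanLessThan
        ug vI uv contv pos] by blast+
  have img: "v ` {-r<..<r} = {c - d<..<c + d} \<inter> u -` {-r<..<r}"
  proof (intro equalityI subsetI)
    fix y assume "y \<in> v ` {-r<..<r}"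
    then show "y \<in> {c - d<..<c + d} \<inter> u -` {-r<..<r}" using vI uv by auto
  next
    fix y assume y: "y \<in> {c - d<..<c + d} \<inter> u -` {-r<..<r}"
    then have "v (u y) = y" by (intro vu) auto
    with y show "y \<in> v ` {-r<..<r}" by (metis IntD2 image_eqI vimageE)
  qed
  have "normal_chart R p \<epsilon> c r u v"
    unfolding normal_chart_def
  proof (intro conjI ballI)
    show "open (v ` {-r<..<r})"
      unfolding img by (rule continuous_open_preimage[OF smooth_on_continuous_on[OF ug]]) auto
    show "smooth_on (v ` {-r<..<r}) u"
      unfolding img using ug smooth_on_subset by blast
    show "v 0 = c" using vu[of c] U(4) d(1) by simp
    fix s assume s: "s \<in> {-r<..<r}"
    have vs: "v s \<in> ?W" using vI[OF s] sub by blast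
    show "vector_derivative v (at s) > 0"
      using vector_derivative_at[OF v'[OF s]] vs by simp
    show "\<bar>v s - c\<bar> < pi" using vI[OF s] d(2) by (simp add: abs_less_iff)
    show "R (v s) = R c + \<epsilon> * s ^ p" using Ru[of "v s"] vs uv[OF s] by simp
  qed (use r v uv in auto)
  then show ?thesis by (rule that)
qed

section \<open>Periodic functions\<close>

lemma periodic_int:
  fixes f :: "real \<Rightarrow> 'a"
  assumes "\<And>t. f (t + 2 * pi) = f t"
  shows "f (t + 2 * pi * of_int k) = f t"
proof -
  have nat: "f (t + 2 * pi * real n) = f t" for n t
  proof (induction n)
    case (Suc n)
    have "f (t + 2 * pi * real (Suc n)) = f (t + 2 * pi * real n + 2 * pi)"
      by (simp add: algebra_simps)
    then show ?case using assms Suc by simp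
  qed simp
  show ?thesis
  proof (cases k)
    case (nonneg n)
    then show ?thesis using nat[of t n] by simp
  next
    case (neg n)
    then have "of_int k = - real (Suc n)" by simp
    then have "t + 2 * pi * of_int k = t - 2 * pi * real (Suc n)"
      by (simp only:)
    then have "f (t + 2 * pi * of_int k) = f (t - 2 * pi * real (Suc n))"
      by (simp only:)
    also have "\<dots> = f t" using nat[of "t - 2 * pi * real (Suc n)" "Suc n"] by simp
    finally show ?thesis .
  qed
qed

text \<open>The representative of \<open>y\<close> modulo \<open>2\<pi>\<close> in \<open>[c - \<pi>, c + \<pi>)\<close>.\<close>

definition circle_rep :: "real \<Rightarrow> real \<Rightarrow> real" where
  "circle_rep c y = y - 2 * pi * of_int \<lfloor>(y - c + pi) / (2 * pi)\<rfloor>"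

lemma circle_rep_range: "c - pi \<le> circle_rep c y" "circle_rep c y < c + pi"
proof -
  let ?q = "(y - c + pi) / (2 * pi)"
  have "of_int \<lfloor>?q\<rfloor> \<le> ?q" "?q < of_int \<lfloor>?q\<rfloor> + 1"
    by linarith+
  then have "2 * pi * of_int \<lfloor>?q\<rfloor> \<le> 2 * pi * ?q" "2 * pi * ?q < 2 * pi * (of_int \<lfloor>?q\<rfloor> + 1)"
    by (intro mult_left_mono mult_strict_left_mono; simp)+
  moreover have "2 * pi * ?q = y - c + pi" by simp
  ultimately have "2 * pi * of_int \<lfloor>?q\<rfloor> \<le> y - c + pi" "y - c + pi < 2 * pi * (of_int \<lfloor>?q\<rfloor> + 1)"
    by simp_all
  then show "c - pi \<le> circle_rep c y" "circle_rep c y < c + pi"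
    by (simp_all add: circle_rep_def algebra_simps)
qed

lemma circle_rep_unique:
  assumes "c - pi \<le> y - 2 * pi * of_int k" "y - 2 * pi * of_int k < c + pi"
  shows "circle_rep c y = y - 2 * pi * of_int k"
proof -
  have "\<lfloor>(y - c + pi) / (2 * pi)\<rfloor> = k"
    using assms by (intro floor_unique) (simp_all add: field_simps)
  then show ?thesis by (simp add: circle_rep_def)
qed

lemma circle_rep_id: "c - pi \<le> y \<Longrightarrow> y < c + pi \<Longrightarrow> circle_rep c y = y"
  using circle_rep_unique[of c y 0] by simp

lemma circle_rep_periodic: "circle_rep c (y + 2 * pi) = circle_rep c y"
proof -
  obtain k where k: "circle_rep c y = y - 2 * pi * of_int k"
    by (simp add: circle_rep_def)
  have "circle_rep c (y + 2 * pi) = y + 2 * pi - 2 * pi * of_int (k + 1)"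
    by (rule circle_rep_unique) (use k circle_rep_range[where c = c and y = y] in \<open>simp_all add: algebra_simps\<close>)
  then show ?thesis using k by (simp add: algebra_simps)
qed

lemma periodic_circle_rep:
  assumes "\<And>t. f (t + 2 * pi) = f t"
  shows "f (circle_rep c y) = f y"
  unfolding circle_rep_def using periodic_int[of f y "- \<lfloor>(y - c + pi) / (2 * pi)\<rfloor>", OF assms] by simp

lemma circle_rep_inj:
  assumes "y \<in> circle" "y' \<in> circle" "circle_rep c y = circle_rep c y'"
  shows "y = y'"
proof -
  obtain k where k: "y = y' + 2 * pi * of_int k"
    using assms(3) by (intro that[of "\<lfloor>(y - c + pi) / (2 * pi)\<rfloor> - \<lfloor>(y' - c + pi) / (2 * pi)\<rfloor>"])
      (simp add: circle_rep_def algebra_simps)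
  have "\<bar>y - y'\<bar> < 2 * pi * 1"
    using assms(1,2) by (auto simp: circle_def abs_less_iff)
  then have "2 * pi * \<bar>of_int k\<bar> < 2 * pi * 1"
    using k by (simp add: abs_mult)
  then have "\<bar>of_int k :: real\<bar> < 1" by simp
  then show ?thesis using k by simp
qed

section \<open>Algebra of smooth functions on the circle\<close>

lemma smooth_on_circle_add:
  "smooth_on_circle f \<Longrightarrow> smooth_on_circle g \<Longrightarrow> smooth_on_circle (\<lambda>y. f y + g y)"
  by (simp add: smooth_on_circle_iff smooth_on_add)

lemma smooth_on_circle_mult:
  fixes f g :: "real \<Rightarrow> 'a::real_normed_algebra"
  shows "smooth_on_circle f \<Longrightarrow> smooth_on_circle g \<Longrightarrow> smooth_on_circle (\<lambda>y. f y * g y)"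
  by (simp add: smooth_on_circle_iff smooth_on_mult)

lemma smooth_on_circle_const: "smooth_on_circle (\<lambda>_. c)"
  by (simp add: smooth_on_circle_iff smooth_on_const)

lemma smooth_on_circle_continuous: "smooth_on_circle f \<Longrightarrow> continuous_on S f"
  by (rule continuous_on_subset[OF smooth_on_continuous_on[of UNIV]]) (simp_all add: smooth_on_circle_iff)

section \<open>Integrals over the torus\<close>

lemma circle_sets: "circle \<in> sets borel" "circle \<times> circle \<in> sets borel"
proof -
  show "circle \<in> sets borel" by (simp add: circle_def)
  then show "circle \<times> circle \<in> sets borel"
    using borel_Times by blast
qed

lemma circle_integral:
  fixes a :: "real \<Rightarrow> complex"
  assumes "continuous_on UNIV a"
  shows "integrable lborel (\<lambda>x. indicator circle x *\<^sub>R a x)"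
    and "integral\<^sup>L lborel (\<lambda>x. indicator circle x *\<^sub>R a x) = integral {0..2 * pi} a"
proof -
  have "negligible ({0..2 * pi} - circle)"
    by (rule negligible_subset[of "{2 * pi}"]) (auto simp: circle_def)
  then have eq: "integral circle a = integral {0..2 * pi} a"
    by (intro integral_subset_negligible) (auto simp: circle_def)
  have "set_integrable lborel {0..2 * pi} a"
    unfolding set_integrable_def
    by (rule borel_integrable_compact) (use assms continuous_on_subset in auto)
  then have "set_integrable lborel circle a"
    by (rule set_integrable_subset) (auto simp: circle_def)
  from this and set_borel_integral_eq_integral(2)[OF this]
  show "integrable lborel (\<lambda>x. indicator circle x *\<^sub>R a x)"
    and "integral\<^sup>L lborel (\<lambda>x. indicator circle x *\<^sub>R a x) = integral {0..2 * pi} a"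
    unfolding set_integrable_def set_lebesgue_integral_def by (simp_all only: eq)
qed

lemma torus_integrable:
  fixes h :: "real \<times> real \<Rightarrow> 'a::{banach, second_countable_topology}"
  assumes "continuous_on UNIV h"
  shows "integrable torus h"
proof -
  have "set_integrable lborel (cbox (0, 0) (2 * pi, 2 * pi)) h"
    unfolding set_integrable_def
    by (rule borel_integrable_compact) (use assms continuous_on_subset in auto)
  then have "set_integrable lborel (circle \<times> circle) h"
    by (rule set_integrable_subset) (use circle_sets in \<open>auto simp: circle_def cbox_Pair_eq\<close>)
  then show ?thesis
    unfolding torus_def set_integrable_def
    by (subst integrable_restrict_space) (use circle_sets in auto)
qed

lemma torus_integral_product:
  fixes a b :: "real \<Rightarrow> complex"
  assumes "continuous_on UNIV a" "continuous_on UNIV b"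
  shows "integral\<^sup>L torus (\<lambda>z. a (fst z) * b (snd z)) = integral {0..2 * pi} a * integral {0..2 * pi} b"
proof -
  let ?a = "\<lambda>x. indicator circle x *\<^sub>R a x" and ?b = "\<lambda>x. indicator circle x *\<^sub>R b x"
  have eq: "(\<lambda>z. indicator (circle \<times> circle) z *\<^sub>R (a (fst z) * b (snd z))) =
      (\<lambda>z. ?a (fst z) * ?b (snd z))"
    by (auto simp: fun_eq_iff indicator_def)
  have "continuous_on UNIV (\<lambda>z::real \<times> real. a (fst z) * b (snd z))"
    by (intro continuous_intros continuous_on_compose2[OF assms(1)] continuous_on_compose2[OF assms(2)]) auto
  from torus_integrable[OF this]
  have "integrable lborel (\<lambda>z. ?a (fst z) * ?b (snd z))"
    unfolding torus_def by (subst (asm) integrable_restrict_space) (use circle_sets eq in auto)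
  then have int: "integrable (lborel \<Otimes>\<^sub>M lborel) (\<lambda>z. ?a (fst z) * ?b (snd z))"
    by (simp add: lborel_prod)
  have "integral\<^sup>L torus (\<lambda>z. a (fst z) * b (snd z)) = integral\<^sup>L (lborel \<Otimes>\<^sub>M lborel) (\<lambda>z. ?a (fst z) * ?b (snd z))"
    unfolding torus_def by (subst integral_restrict_space) (use circle_sets eq in \<open>auto simp: lborel_prod\<close>)
  also have "\<dots> = (\<integral>x. (\<integral>y. ?a x * ?b y \<partial>lborel) \<partial>lborel)"
    using lborel_pair.integral_fst'[OF int] by simp
  also have "\<dots> = (\<integral>x. ?a x * (\<integral>y. ?b y \<partial>lborel) \<partial>lborel)"
    by (simp only: integral_mult_right_zero)
  also have "\<dots> = (\<integral>x. ?a x \<partial>lborel) * (\<integral>y. ?b y \<partial>lborel)"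
    by (simp only: integral_mult_left_zero)
  finally show ?thesis
    by (simp only: circle_integral[OF assms(1)] circle_integral[OF assms(2)])
qed

lemma integral_exp_int:
  "integral {0..2 * pi} (\<lambda>x. exp (\<i> * of_int m * of_real x)) = (if m = 0 then 2 * of_real pi else 0)"
proof (cases "m = 0")
  case True
  then show ?thesis by (simp add: scaleR_conv_of_real)
next
  case False
  have "((\<lambda>x. exp (\<i> * of_int m * of_real x)) has_integral
      exp (\<i> * of_int m * of_real (2 * pi)) / (\<i> * of_int m) - exp (\<i> * of_int m * of_real 0) / (\<i> * of_int m))
      {0..2 * pi}"
  proof (rule fundamental_theorem_of_calculus)
    fix x :: real
    have "((\<lambda>x. exp (\<i> * of_int m * of_real x) / (\<i> * of_int m)) has_vector_derivative
        exp (\<i> * of_int m * of_real x)) (at x)"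
      by (rule has_vector_derivative_real_field) (use False in \<open>auto intro!: derivative_eq_intros\<close>)
    then show "((\<lambda>x. exp (\<i> * of_int m * of_real x) / (\<i> * of_int m)) has_vector_derivative
        exp (\<i> * of_int m * of_real x)) (at x within {0..2 * pi})"
      by (rule has_vector_derivative_at_within)
  qed simp
  moreover have "exp (\<i> * of_int m * of_real (2 * pi)) = 1"
    using exp_integer_2pi[of "of_int m"] by (simp add: mult_ac)
  ultimately show ?thesis using False by (simp add: integral_unique)
qed

section \<open>Mode expansions\<close>

definition of_modes :: "(int \<Rightarrow> real \<Rightarrow> complex) \<Rightarrow> haux" where
  "of_modes c = abs_haux (mode_sum c)"

text \<open>Frees the sum from the exact support, so that families with different supports can be
  compared over one finite index set.\<close>

lemma mode_sum_superset:
  assumes "finite S" "{m. c m \<noteq> (\<lambda>_. 0)} \<subseteq> S"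
  shows "mode_sum c z = (\<Sum>m\<in>S. exp (\<i> * of_int m * of_real (fst z)) * c m (snd z))"
  unfolding mode_sum_def split_beta
  by (rule sum.mono_neutral_left) (use assms in auto)

lemma mode_families_finite: "c \<in> mode_families \<Longrightarrow> finite {m. c m \<noteq> (\<lambda>_. 0)}"
  and mode_families_smooth: "c \<in> mode_families \<Longrightarrow> smooth_on_circle (c m)"
  by (simp_all add: mode_families_def)

lemma mode_sum_continuous:
  assumes "c \<in> mode_families"
  shows "continuous_on UNIV (mode_sum c)"
proof -
  have "continuous_on UNIV (\<lambda>z::real \<times> real. c m (snd z))" for m
    by (rule continuous_on_compose2[OF smooth_on_circle_continuous[OF mode_families_smooth[OF assms]]])
      (auto intro: continuous_intros)
  then show ?thesis
    unfolding mode_sum_def split_beta by (intro continuous_intros)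
qed

lemma mode_sum_square_integrable:
  assumes "c \<in> mode_families"
  shows "square_integrable (mode_sum c)"
  unfolding square_integrable_def
proof
  show "mode_sum c \<in> borel_measurable torus"
    using torus_integrable[OF mode_sum_continuous[OF assms]] by (rule borel_measurable_integrable)
  show "integrable torus (\<lambda>z. (cmod (mode_sum c z))\<^sup>2)"
    by (intro torus_integrable continuous_intros mode_sum_continuous assms)
qed

lemma mode_sum_ae_equal: "c \<in> mode_families \<Longrightarrow> ae_equal (mode_sum c) (mode_sum c)"
  by (simp add: ae_equal_def mode_sum_square_integrable)

section \<open>Linear structure of mode families and of the vectors that they represent\<close>

lemma mode_families_add:
  assumes "c \<in> mode_families" "d \<in> mode_families"
  shows "(\<lambda>m y. c m y + d m y) \<in> mode_families"
  using assms by (auto simp: mode_families_def smooth_on_circle_add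
      intro!: finite_subset[of _ "{m. c m \<noteq> (\<lambda>_. 0)} \<union> {m. d m \<noteq> (\<lambda>_. 0)}"])

lemma mode_families_scale:
  assumes "c \<in> mode_families"
  shows "(\<lambda>m y. a * c m y) \<in> mode_families"
  using assms by (auto simp: mode_families_def intro!: smooth_on_circle_mult smooth_on_circle_const
      finite_subset[of _ "{m. c m \<noteq> (\<lambda>_. 0)}"])

lemma mode_families_zero: "(\<lambda>_ _. 0) \<in> mode_families"
  by (simp add: mode_families_def smooth_on_circle_const)

lemma of_modes_zero: "of_modes (\<lambda>_ _. 0) = 0"
proof -
  have "mode_sum (\<lambda>_ _. 0) = (\<lambda>_. 0)" by (auto simp: mode_sum_def)
  then show ?thesis by (simp add: of_modes_def zero_haux_def)
qed

lemma of_modes_add: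
  assumes "c \<in> mode_families" "d \<in> mode_families"
  shows "of_modes (\<lambda>m y. c m y + d m y) = of_modes c + of_modes d"
proof -
  let ?S = "{m. c m \<noteq> (\<lambda>_. 0)} \<union> {m. d m \<noteq> (\<lambda>_. 0)}"
  have "finite ?S" using assms by (simp add: mode_families_finite)
  then have "mode_sum (\<lambda>m y. c m y + d m y) z = mode_sum c z + mode_sum d z" for z
    by (subst (1 2 3) mode_sum_superset[of ?S]) (auto simp: distrib_left sum.distrib)
  then have "mode_sum (\<lambda>m y. c m y + d m y) = (\<lambda>z. mode_sum c z + mode_sum d z)"
    by blast
  then show ?thesis
    using plus_haux.abs_eq[OF mode_sum_ae_equal[OF assms(1)] mode_sum_ae_equal[OF assms(2)]]
    by (simp add: of_modes_def)
qed

lemma of_modes_scale: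
  assumes "c \<in> mode_families"
  shows "of_modes (\<lambda>m y. a * c m y) = cscale a (of_modes c)"
proof -
  have "finite {m. c m \<noteq> (\<lambda>_. 0)}" using assms by (simp add: mode_families_finite)
  then have "mode_sum (\<lambda>m y. a * c m y) z = a * mode_sum c z" for z
    by (subst (1 2) mode_sum_superset[of "{m. c m \<noteq> (\<lambda>_. 0)}"])
      (auto simp: sum_distrib_left mult_ac)
  then have "mode_sum (\<lambda>m y. a * c m y) = (\<lambda>z. a * mode_sum c z)"
    by blast
  then show ?thesis
    using cscale.abs_eq[OF mode_sum_ae_equal[OF assms]] by (simp add: of_modes_def)
qed

text \<open>Parseval in the variable \<open>x\<close>: each pair of modes factorises by Fubini, and
  orthogonality of the exponentials leaves the diagonal with weight \<open>2 * pi\<close>.\<close>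

lemma l2_inner_of_modes:
  assumes "c \<in> mode_families" "d \<in> mode_families" "finite S"
    and "{m. c m \<noteq> (\<lambda>_. 0)} \<subseteq> S" "{m. d m \<noteq> (\<lambda>_. 0)} \<subseteq> S"
  shows "l2_inner (of_modes c) (of_modes d) =
    2 * of_real pi * (\<Sum>m\<in>S. integral {0..2 * pi} (\<lambda>y. cnj (c m y) * d m y))"
proof -
  let ?e = "\<lambda>m x. exp (\<i> * of_int m * of_real x)"
  let ?g = "\<lambda>m n y. cnj (c m y) * d n y"
  have e: "continuous_on UNIV (?e m)" for m by (intro continuous_intros)
  have g: "continuous_on UNIV (?g m n)" for m n
    using assms(1,2) by (intro continuous_intros smooth_on_circle_continuous mode_families_smooth)
  have int: "integrable torus (\<lambda>z. ?e (n - m) (fst z) * ?g m n (snd z))" for m n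
    by (intro torus_integrable continuous_intros continuous_on_compose2[OF g]) auto
  have "cnj (mode_sum c z) * mode_sum d z = (\<Sum>m\<in>S. \<Sum>n\<in>S. ?e (n - m) (fst z) * ?g m n (snd z))" for z
    unfolding mode_sum_superset[OF assms(3,4)] mode_sum_superset[OF assms(3,5)] cnj_sum sum_product
    by (intro sum.cong refl)
      (simp add: exp_cnj left_diff_distrib right_diff_distrib exp_diff exp_minus field_simps)
  then have "l2_inner (of_modes c) (of_modes d) =
      integral\<^sup>L torus (\<lambda>z. \<Sum>m\<in>S. \<Sum>n\<in>S. ?e (n - m) (fst z) * ?g m n (snd z))"
    unfolding of_modes_def l2_inner.abs_eq[OF mode_sum_ae_equal[OF assms(1)] mode_sum_ae_equal[OF assms(2)]]
    by simp
  also have "\<dots> = (\<Sum>m\<in>S. \<Sum>n\<in>S. integral {0..2 * pi} (?e (n - m)) * integral {0..2 * pi} (?g m n))"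
    using int by (simp only: Bochner_Integration.integral_sum Bochner_Integration.integrable_sum
        torus_integral_product[OF e g])
  also have "\<dots> = (\<Sum>m\<in>S. \<Sum>n\<in>S. if n = m then 2 * of_real pi * integral {0..2 * pi} (?g m m) else 0)"
    unfolding integral_exp_int by (intro sum.cong refl) auto
  also have "\<dots> = 2 * of_real pi * (\<Sum>m\<in>S. integral {0..2 * pi} (?g m m))"
    using assms(3) by (simp add: sum_distrib_left)
  finally show ?thesis .
qed

text \<open>Equality in \<open>haux\<close> holds only almost everywhere. Applied to the difference,
  Parseval makes the integral of each squared modulus vanish, and continuity upgrades this to
  vanishing at every point. Point values of modes, on which the rigging map is built, are thereby
  well defined.\<close>

lemma of_modes_inj:
  assumes c: "c \<in> mode_families" and d: "d \<in> mode_families" and eq: "of_modes c = of_modes d"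
  shows "c = d"
proof -
  define e where "e = (\<lambda>m y. c m y + (- 1) * d m y)"
  have e: "e \<in> mode_families"
    unfolding e_def by (intro mode_families_add mode_families_scale c d)
  have "of_modes e = of_modes c + cscale (- 1) (of_modes d)"
    unfolding e_def by (subst of_modes_add[OF c mode_families_scale[OF d]]) (simp only: of_modes_scale[OF d])
  also have "\<dots> = of_modes (\<lambda>m y. d m y + (- 1) * d m y)"
    unfolding eq by (subst of_modes_add[OF d mode_families_scale[OF d]]) (simp only: of_modes_scale[OF d])
  also have "\<dots> = of_modes (\<lambda>_ _. 0)" by simp
  finally have zero: "of_modes e = of_modes (\<lambda>_ _. 0)" .
  let ?S = "{m. e m \<noteq> (\<lambda>_. 0)}"
  let ?I = "\<lambda>m. integral {0..2 * pi} (\<lambda>y. (cmod (e m y))\<^sup>2)"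
  have S: "finite ?S" by (rule mode_families_finite[OF e])
  have cont: "continuous_on T (e m)" for m T
    by (rule smooth_on_circle_continuous[OF mode_families_smooth[OF e]])
  have sq: "integral {0..2 * pi} (\<lambda>y. cnj (e m y) * e m y) = of_real (?I m)" for m
  proof -
    have "(\<lambda>y. (cmod (e m y))\<^sup>2) integrable_on {0..2 * pi}"
      by (intro integrable_continuous_interval continuous_intros cont)
    then have "((\<lambda>y. of_real ((cmod (e m y))\<^sup>2) :: complex) has_integral of_real (?I m)) {0..2 * pi}"
      using has_integral_linear[OF integrable_integral bounded_linear_of_real] by (simp add: o_def del: of_real_power)
    then have "((\<lambda>y. cnj (e m y) * e m y) has_integral of_real (?I m)) {0..2 * pi}"
      by (simp only: complex_norm_square mult.commute)
    then show ?thesis by (rule integral_unique)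
  qed
  have "2 * of_real pi * (\<Sum>m\<in>?S. complex_of_real (?I m)) = l2_inner (of_modes e) (of_modes e)"
    unfolding l2_inner_of_modes[OF e e S order_refl order_refl] sq ..
  also have "\<dots> = 0"
    unfolding zero by (subst l2_inner_of_modes[OF mode_families_zero mode_families_zero, of "{}"]) auto
  finally have "complex_of_real (\<Sum>m\<in>?S. ?I m) = 0" by simp
  then have "(\<Sum>m\<in>?S. ?I m) = 0" by (simp only: of_real_eq_0_iff)
  moreover have "?I m \<ge> 0" for m
    by (rule integral_nonneg) (auto intro!: integrable_continuous_interval continuous_intros cont)
  ultimately have I: "?I m = 0" if "m \<in> ?S" for m
    using sum_nonneg_eq_0_iff[OF S, of ?I] that by simp
  have "e m = (\<lambda>_. 0)" for m
  proof (rule ccontr)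
    assume "e m \<noteq> (\<lambda>_. 0)"
    then have "?I m = 0" using I by simp
    moreover have "continuous_on {0..2 * pi} (\<lambda>y. (cmod (e m y))\<^sup>2)"
      by (intro continuous_intros cont)
    ultimately have *: "e m y = 0" if "y \<in> {0..2 * pi}" for y
      using integral_eq_0_iff[of 0 "2 * pi" "\<lambda>y. (cmod (e m y))\<^sup>2"] that by simp
    have "e m y = 0" for y
    proof -
      have "e m (circle_rep pi y) = e m y"
        using mode_families_smooth[OF e, of m] by (intro periodic_circle_rep) (simp add: smooth_on_circle_iff)
      then show ?thesis
        using *[of "circle_rep pi y"] circle_rep_range[of pi y] by simp
    qed
    with \<open>e m \<noteq> (\<lambda>_. 0)\<close> show False by auto
  qed
  then show ?thesis
    by (simp add: e_def fun_eq_iff)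
qed

lemma mode_of_modes:
  assumes "c \<in> mode_families"
  shows "mode (of_modes c) = c"
  unfolding mode_def of_modes_def[symmetric]
proof (rule the_equality)
  show "d = c" if "d \<in> mode_families \<and> of_modes c = of_modes d" for d
    by (rule of_modes_inj) (use assms that in simp_all)
qed (simp add: assms)

lemma test_space_eq: "test_space = of_modes ` mode_families"
  by (auto simp: test_space_def of_modes_def)

lemma evolve_modes_in:
  assumes "smooth_on_circle R" "c \<in> mode_families"
  shows "evolve_modes R t c \<in> mode_families"
proof -
  have "smooth_on_circle (\<lambda>y. exp (- \<i> * of_real (t * ((of_int m)\<^sup>2 - R y))))" for m
  proof -
    have "smooth_on UNIV (\<lambda>y. exp (- \<i> * of_real (t * ((of_int m)\<^sup>2 + (- 1) * R y))))"
      by (rule smooth_on_compose[OF smooth_on_exp])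
        (use assms(1) in \<open>auto intro!: smooth_on_mult smooth_on_add smooth_on_const simp only: smooth_on_circle_iff\<close>)
    with assms(1) show ?thesis by (simp add: smooth_on_circle_iff)
  qed
  then show ?thesis
    using assms(2) unfolding mode_families_def evolve_modes_support mem_Collect_eq
    by (auto simp: evolve_modes_def intro!: smooth_on_circle_mult)
qed

lemma evolution_of_modes:
  "c \<in> mode_families \<Longrightarrow> evolution R t (of_modes c) = of_modes (evolve_modes R t c)"
  by (simp add: evolution_def mode_of_modes of_modes_def[symmetric])

section \<open>Observables between two modes\<close>

definition mode_map :: "int \<Rightarrow> int \<Rightarrow> ((real \<Rightarrow> complex) \<Rightarrow> real \<Rightarrow> complex) \<Rightarrow>
    (int \<Rightarrow> real \<Rightarrow> complex) \<Rightarrow> int \<Rightarrow> real \<Rightarrow> complex" where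
  "mode_map m1 m2 T c = (\<lambda>m. if m = m2 then T (c m1) else (\<lambda>_. 0))"

text \<open>The domain is exactly the test space, so membership in the adjoint only has to be tested
  against test vectors.\<close>

definition mode_operator ::
    "int \<Rightarrow> int \<Rightarrow> ((real \<Rightarrow> complex) \<Rightarrow> real \<Rightarrow> complex) \<Rightarrow> (haux \<times> haux) set" where
  "mode_operator m1 m2 T = (\<lambda>c. (of_modes c, of_modes (mode_map m1 m2 T c))) ` mode_families"

lemma mode_map_in:
  assumes "c \<in> mode_families" "\<And>f. smooth_on_circle f \<Longrightarrow> smooth_on_circle (T f)"
  shows "mode_map m1 m2 T c \<in> mode_families"
proof -
  have "{m. mode_map m1 m2 T c m \<noteq> (\<lambda>_. 0)} \<subseteq> {m2}"
    by (auto simp: mode_map_def)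
  then have "finite {m. mode_map m1 m2 T c m \<noteq> (\<lambda>_. 0)}"
    by (rule finite_subset) simp
  then show ?thesis
    using assms by (auto simp: mode_families_def mode_map_def smooth_on_circle_const)
qed

text \<open>Reduces observability to conditions in the variable \<open>y\<close> alone. The adjoint
  exchanges the two modes and uses \<open>T'\<close>; commutation with the evolution becomes an
  intertwining of the phase factors of mode \<open>m1\<close> with those of mode
  \<open>m2\<close>.\<close>

lemma mode_operator_observable:
  assumes R: "smooth_on_circle R"
    and T: "\<And>f. smooth_on_circle f \<Longrightarrow> smooth_on_circle (T f)"
    and T': "\<And>f. smooth_on_circle f \<Longrightarrow> smooth_on_circle (T' f)"
    and add: "\<And>f g. T (\<lambda>y. f y + g y) = (\<lambda>y. T f y + T g y)"
    and scale: "\<And>a f. T (\<lambda>y. a * f y) = (\<lambda>y. a * T f y)"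
    and adj: "\<And>f h. smooth_on_circle f \<Longrightarrow> smooth_on_circle h \<Longrightarrow>
      integral {0..2 * pi} (\<lambda>y. cnj (h y) * T f y) = integral {0..2 * pi} (\<lambda>y. cnj (T' h y) * f y)"
    and comm: "\<And>t f. T (\<lambda>y. exp (- \<i> * of_real (t * ((of_int m1)\<^sup>2 - R y))) * f y) =
      (\<lambda>y. exp (- \<i> * of_real (t * ((of_int m2)\<^sup>2 - R y))) * T f y)"
  shows "mode_operator m1 m2 T \<in> observables R"
proof -
  let ?A = "mode_operator m1 m2 T" and ?M = "mode_map m1 m2 T" and ?M' = "mode_map m2 m1 T'"
  have MF: "?M c \<in> mode_families" "?M' c \<in> mode_families" if "c \<in> mode_families" for c
    using that T T' by (auto intro: mode_map_in)
  have zero: "T (\<lambda>_. 0) = (\<lambda>_. 0)" using scale[of 0 "\<lambda>_. 0"] by simp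
  have "linear_operator ?A"
    unfolding linear_operator_def
  proof (intro conjI allI impI)
    show "single_valued ?A"
      unfolding single_valued_def mode_operator_def using of_modes_inj by blast
    have "?M (\<lambda>_ _. 0) = (\<lambda>_ _. 0)" by (auto simp: mode_map_def zero)
    then show "(0, 0) \<in> ?A"
      using mode_families_zero of_modes_zero by (auto simp: mode_operator_def image_iff)
  next
    fix f g f' g' assume "(f, g) \<in> ?A" "(f', g') \<in> ?A"
    then obtain c d where cd: "c \<in> mode_families" "d \<in> mode_families"
      "f = of_modes c" "g = of_modes (?M c)" "f' = of_modes d" "g' = of_modes (?M d)"
      by (auto simp: mode_operator_def)
    have "?M (\<lambda>m y. c m y + d m y) = (\<lambda>m y. ?M c m y + ?M d m y)"
      by (auto simp: mode_map_def add fun_eq_iff)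
    then have "(f + f', g + g') = (\<lambda>c. (of_modes c, of_modes (?M c))) (\<lambda>m y. c m y + d m y)"
      using cd MF by (simp add: of_modes_add)
    then show "(f + f', g + g') \<in> ?A"
      unfolding mode_operator_def using mode_families_add[OF cd(1,2)] by (rule image_eqI)
  next
    fix a f g assume "(f, g) \<in> ?A"
    then obtain c where c: "c \<in> mode_families" "f = of_modes c" "g = of_modes (?M c)"
      by (auto simp: mode_operator_def)
    have "?M (\<lambda>m y. a * c m y) = (\<lambda>m y. a * ?M c m y)"
      by (auto simp: mode_map_def scale fun_eq_iff)
    then have "(cscale a f, cscale a g) = (\<lambda>c. (of_modes c, of_modes (?M c))) (\<lambda>m y. a * c m y)"
      using c MF by (simp add: of_modes_scale)
    then show "(cscale a f, cscale a g) \<in> ?A"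
      unfolding mode_operator_def using mode_families_scale[OF c(1)] by (rule image_eqI)
  qed
  moreover have "preserves ?A test_space"
    using MF by (auto simp: preserves_def test_space_eq mode_operator_def)
  moreover have "preserves (adjoint_op ?A) test_space"
  proof -
    have "(of_modes d, of_modes (?M' d)) \<in> adjoint_op ?A" if d: "d \<in> mode_families" for d
    proof -
      have "l2_inner (of_modes d) (of_modes (?M c)) = l2_inner (of_modes (?M' d)) (of_modes c)"
        if c: "c \<in> mode_families" for c
      proof -
        \<comment> \<open>Adjoining \<open>m1\<close> and \<open>m2\<close> lets both inner products
          be expanded over the same set, with one surviving term on each side.\<close>
        let ?S = "{m. c m \<noteq> (\<lambda>_. 0)} \<union> {m. d m \<noteq> (\<lambda>_. 0)} \<union> {m1, m2}"
        have S: "finite ?S" using c d by (simp add: mode_families_finite)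
        have "l2_inner (of_modes d) (of_modes (?M c)) =
            2 * of_real pi * (\<Sum>m\<in>?S. integral {0..2 * pi} (\<lambda>y. cnj (d m y) * ?M c m y))"
          by (rule l2_inner_of_modes[OF d MF(1)[OF c] S]) (auto simp: mode_map_def)
        also have "(\<Sum>m\<in>?S. integral {0..2 * pi} (\<lambda>y. cnj (d m y) * ?M c m y)) =
            (\<Sum>m\<in>?S. if m = m2 then integral {0..2 * pi} (\<lambda>y. cnj (d m2 y) * T (c m1) y) else 0)"
          by (intro sum.cong refl) (simp add: mode_map_def)
        also have "\<dots> = integral {0..2 * pi} (\<lambda>y. cnj (d m2 y) * T (c m1) y)"
          using S by (subst sum.delta) auto
        also have "\<dots> = integral {0..2 * pi} (\<lambda>y. cnj (T' (d m2) y) * c m1 y)"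
          by (intro adj mode_families_smooth c d)
        also have "\<dots> = (\<Sum>m\<in>?S. if m = m1 then integral {0..2 * pi} (\<lambda>y. cnj (T' (d m2) y) * c m1 y) else 0)"
          using S by (subst sum.delta) auto
        also have "\<dots> = (\<Sum>m\<in>?S. integral {0..2 * pi} (\<lambda>y. cnj (?M' d m y) * c m y))"
          by (intro sum.cong refl) (simp add: mode_map_def)
        also have "2 * of_real pi * \<dots> = l2_inner (of_modes (?M' d)) (of_modes c)"
          by (rule l2_inner_of_modes[OF MF(2)[OF d] c S, symmetric]) (auto simp: mode_map_def)
        finally show ?thesis .
      qed
      then show ?thesis
        by (auto simp: adjoint_op_def mode_operator_def)
    qed
    then show ?thesis
      using MF by (auto simp: preserves_def test_space_eq)
  qed
  moreover have "(evolution R t f, evolution R t g) \<in> ?A" if "(f, g) \<in> ?A" for t f g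
  proof -
    obtain c where c: "c \<in> mode_families" "f = of_modes c" "g = of_modes (?M c)"
      using \<open>(f, g) \<in> ?A\<close> by (auto simp: mode_operator_def)
    have "?M (evolve_modes R t c) = evolve_modes R t (?M c)"
      unfolding mode_map_def evolve_modes_def comm by auto
    then have "(evolution R t f, evolution R t g) =
        (\<lambda>c. (of_modes c, of_modes (?M c))) (evolve_modes R t c)"
      using c MF by (simp add: evolution_of_modes)
    then show ?thesis
      unfolding mode_operator_def using evolve_modes_in[OF R c(1)] by (rule image_eqI)
  qed
  ultimately show ?thesis
    by (auto simp: observables_def)
qed

section \<open>Transport along normal charts\<close>

text \<open>A function \<open>k\<close> of the chart coordinate is placed on the circle and extended
  by zero. Only \<open>circle_rep c y\<close> enters, which builds in periodicity.\<close>

definition transport ::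
  "real \<Rightarrow> real \<Rightarrow> (real \<Rightarrow> real) \<Rightarrow> (real \<Rightarrow> real) \<Rightarrow> (real \<Rightarrow> complex) \<Rightarrow> real \<Rightarrow> complex" where
  "transport c r u v k y = (if circle_rep c y \<in> v ` {-r<..<r} then k (u (circle_rep c y)) else 0)"

lemma transport_at:
  assumes "normal_chart R p \<epsilon> c r u v" "s \<in> {-r<..<r}" "circle_rep c y = v s"
  shows "transport c r u v k y = k s"
  using assms by (auto simp: transport_def normal_chart_def)

lemma transport_off: "circle_rep c y \<notin> v ` {-r<..<r} \<Longrightarrow> transport c r u v k y = 0"
  by (simp add: transport_def)

lemma transport_periodic: "transport c r u v k (y + 2 * pi) = transport c r u v k y"
  by (simp add: transport_def circle_rep_periodic)

lemma normal_chart_strict_mono: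
  assumes "normal_chart R p \<epsilon> c r u v" "-r < s" "s < t" "t < r"
  shows "v s < v t"
proof (rule DERIV_pos_imp_increasing[OF assms(3)])
  fix x assume "s \<le> x" "x \<le> t"
  then have x: "x \<in> {-r<..<r}" using assms by auto
  then have "(v has_real_derivative vector_derivative v (at x)) (at x)" "vector_derivative v (at x) > 0"
    using assms(1) smooth_on_has_vector_derivative[of "{-r<..<r}" v x]
    by (auto simp: normal_chart_def has_real_derivative_iff_has_vector_derivative)
  then show "\<exists>D. (v has_real_derivative D) (at x) \<and> D > 0" by blast
qed

text \<open>Since \<open>k\<close> vanishes on the collar between \<open>\<rho>\<close> and
  \<open>r\<close>, the extension by zero is smooth. Two kinds of open sets cover the line:
  translates of the chart image, where the function is a composition of smooth maps, and the
  complement of all translates of the smaller compact image, where it is zero.\<close>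

lemma smooth_on_circle_transport:
  assumes chart: "normal_chart R p \<epsilon> c r u v"
    and k: "smooth_on {-r<..<r} k" and \<rho>: "\<rho> < r" and supp: "\<And>s. \<rho> \<le> \<bar>s\<bar> \<Longrightarrow> k s = 0"
  shows "smooth_on_circle (transport c r u v k)"
proof -
  let ?J = "v ` {-r<..<r}" and ?K = "v ` {-\<rho>..\<rho>}" and ?f = "transport c r u v k"
  have J: "open ?J" "smooth_on ?J u" and v: "smooth_on {-r<..<r} v"
    using chart by (auto simp: normal_chart_def)
  have near: "\<bar>y - c\<bar> < pi" "u y \<in> {-r<..<r}" if "y \<in> ?J" for y
    using chart that by (auto simp: normal_chart_def)
  have KJ: "?K \<subseteq> ?J" using \<rho> by auto
  have "\<exists>U. t \<in> U \<and> smooth_on U ?f" for t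
  proof (cases "circle_rep c t \<in> ?J")
    case True
    obtain n where n: "circle_rep c t = t - 2 * pi * of_int n"
      by (simp add: circle_rep_def)
    define U where "U = (\<lambda>y. y - 2 * pi * of_int n) -` ?J"
    have "open U"
      unfolding U_def by (intro open_vimage J continuous_intros)
    \<comment> \<open>The integer \<open>n\<close> is constant on \<open>U\<close> because the chart
      image stays at distance less than \<open>pi\<close> from \<open>c\<close>, away from the jump
      of \<open>circle_rep\<close>.\<close>
    have rep: "circle_rep c y = y - 2 * pi * of_int n" if "y \<in> U" for y
      using near(1)[of "y - 2 * pi * of_int n"] that by (intro circle_rep_unique) (auto simp: U_def abs_less_iff)
    have "smooth_on U (\<lambda>y. k (u (y - 2 * pi * of_int n)))"
    proof (rule smooth_on_compose[OF k _ \<open>open U\<close>])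
      show "smooth_on U (\<lambda>y. u (y - 2 * pi * of_int n))"
        by (rule smooth_on_compose[OF J(2,1) \<open>open U\<close>])
          (auto simp: U_def intro!: smooth_on_diff_const smooth_on_ident \<open>open U\<close>[unfolded U_def])
    qed (use near(2) in \<open>auto simp: U_def\<close>)
    then have "smooth_on U ?f"
      by (rule smooth_on_cong[OF _ \<open>open U\<close>]) (auto simp: transport_def rep U_def)
    moreover have "t \<in> U" using True n by (simp add: U_def)
    ultimately show ?thesis by blast
  next
    case False
    \<comment> \<open>The union of all translates of \<open>?K\<close> by multiples of \<open>2\<pi>\<close> is the preimage of a compact set under
      \<open>cis\<close>, hence closed.\<close>
    define U where "U = cis -` (- cis ` ?K)"
    have "continuous_on {-\<rho>..\<rho>} v"
      by (rule continuous_on_subset[OF smooth_on_continuous_on[OF v]]) (use \<rho> in auto)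
    then have "compact (cis ` ?K)"
      by (intro compact_continuous_image continuous_intros compact_Icc)
    then have "open U"
      unfolding U_def by (intro open_vimage continuous_intros open_Compl compact_imp_closed)
    have "?f y = 0" if "y \<in> U" for y
    proof (rule ccontr)
      assume nz: "?f y \<noteq> 0"
      then obtain s where s: "s \<in> {-r<..<r}" "circle_rep c y = v s"
        by (auto simp: transport_def split: if_splits)
      then have "k s \<noteq> 0" using nz transport_at[OF chart s] by simp
      then have "\<bar>s\<bar> < \<rho>" using supp[of s] by force
      then have "s \<in> {-\<rho>..\<rho>}" by auto
      then have "circle_rep c y \<in> ?K" unfolding s(2) by (rule imageI)
      moreover have "cis (circle_rep c y) = cis y"
        by (rule periodic_circle_rep) (simp add: cis_mult[symmetric])
      ultimately have "cis y \<in> cis ` ?K" by (metis imageI)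
      with that show False by (simp add: U_def)
    qed
    then have "smooth_on U ?f"
      using smooth_on_cong[OF smooth_on_const[of U 0] \<open>open U\<close>, of ?f] by simp
    moreover have "t \<in> U"
    proof (rule ccontr)
      assume "t \<notin> U"
      then obtain \<kappa> where \<kappa>: "\<kappa> \<in> ?K" "cis t = cis \<kappa>" by (auto simp: U_def)
      then have "sin t = sin \<kappa> \<and> cos t = cos \<kappa>"
        by (simp add: complex_eq_iff)
      then obtain n :: int where "t = \<kappa> + 2 * pi * of_int n"
        using sin_cos_eq_iff[of t \<kappa>] by (auto simp: mult_ac)
      moreover have "\<bar>\<kappa> - c\<bar> < pi" using near \<kappa>(1) KJ by blast
      ultimately have "circle_rep c t = \<kappa>"
        using circle_rep_unique[of c t n] by (simp add: abs_less_iff)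
      with \<kappa>(1) KJ False show False by auto
    qed
    ultimately show ?thesis by blast
  qed
  then have "smooth_on UNIV ?f" using smooth_on_local by blast
  then show ?thesis by (simp add: smooth_on_circle_iff transport_periodic)
qed

text \<open>The window is cut at a multiple \<open>b\<close> of the period inside it. Moving the
  left piece forward by one period produces the window that starts at \<open>b\<close>, a translate
  of the standard one.\<close>

lemma integral_periodic_shift:
  fixes f :: "real \<Rightarrow> complex"
  assumes per: "\<And>t. f (t + 2 * pi) = f t" and cont: "continuous_on UNIV f"
  shows "integral {a..a + 2 * pi} f = integral {0..2 * pi} f"
proof -
  define k where "k = \<lceil>a / (2 * pi)\<rceil>"
  define b where "b = 2 * pi * of_int k"
  have "a / (2 * pi) \<le> of_int k" "of_int k < a / (2 * pi) + 1"
    unfolding k_def by linarith+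
  then have ab: "a \<le> b" "b \<le> a + 2 * pi"
    by (simp_all add: b_def field_simps)
  have int: "f integrable_on {x..y}" for x y
    by (rule integrable_continuous_interval) (use cont continuous_on_subset in blast)
  have shift: "integral {x..y} f = integral {x + 2 * pi * of_int n..y + 2 * pi * of_int n} f" for x y n
    using integral_shift[where f = f and a = x and b = y and c = "2 * pi * of_int n"] periodic_int[of f, OF per] cont continuous_on_subset
    by (fastforce simp: o_def)
  have "integral {a..a + 2 * pi} f = integral {a..b} f + integral {b..a + 2 * pi} f"
    using Henstock_Kurzweil_Integration.integral_combine[OF ab int] by simp
  also have "integral {a..b} f = integral {a + 2 * pi..b + 2 * pi} f"
    using shift[of a b 1] by simp
  also have "\<dots> + integral {b..a + 2 * pi} f = integral {b..b + 2 * pi} f"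
    using Henstock_Kurzweil_Integration.integral_combine[of b "a + 2 * pi" "b + 2 * pi" f] ab int by (simp add: add.commute)
  also have "\<dots> = integral {0..2 * pi} f"
    using shift[of 0 "2 * pi" k] by (simp add: b_def add.commute)
  finally show ?thesis .
qed

text \<open>Substitution \<open>y = v s\<close>, after moving the period window so that it is
  centred at \<open>c\<close> and contains the chart image in its interior.\<close>

lemma integral_transport:
  assumes chart: "normal_chart R p \<epsilon> c r u v"
    and k: "smooth_on {-r<..<r} k" and \<rho>: "0 < \<rho>" "\<rho> < r" and supp: "\<And>s. \<rho> \<le> \<bar>s\<bar> \<Longrightarrow> k s = 0"
    and h: "\<And>t. h (t + 2 * pi) = h t" "continuous_on UNIV h"
  shows "integral {0..2 * pi} (\<lambda>y. h y * transport c r u v k y) =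
    integral {-\<rho>..\<rho>} (\<lambda>s. vector_derivative v (at s) *\<^sub>R (h (v s) * k s))"
proof -
  let ?f = "transport c r u v k"
  let ?g = "\<lambda>y. h y * ?f y"
  note smooth = smooth_on_circle_transport[OF chart k \<rho>(2) supp]
  have cont: "continuous_on S ?g" for S
    using smooth_on_circle_continuous[OF smooth] continuous_on_subset[OF h(2)] by (intro continuous_intros) auto
  have vlt: "\<bar>v s - c\<bar> < pi" and v': "(v has_real_derivative vector_derivative v (at s)) (at s)" if "s \<in> {-r<..<r}" for s
    using chart that smooth_on_has_vector_derivative[of "{-r<..<r}" v s]
    by (auto simp: normal_chart_def has_real_derivative_iff_has_vector_derivative)
  have mono: "v s \<le> v t" if "-r < s" "s \<le> t" "t < r" for s t
    using normal_chart_strict_mono[OF chart, of s t] that by (cases "s = t") auto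
  have zero: "?g y = 0" if "y \<in> {c - pi..c + pi}" "y \<notin> {v (-\<rho>)..v \<rho>}" for y
  proof (rule ccontr)
    assume "?g y \<noteq> 0"
    then have nz: "?f y \<noteq> 0" by auto
    then obtain s where s: "s \<in> {-r<..<r}" "circle_rep c y = v s"
      by (auto simp: transport_def split: if_splits)
    then have "k s \<noteq> 0" using nz transport_at[OF chart s] by simp
    then have "\<bar>s\<bar> < \<rho>" using supp[of s] by force
    then have "v (-\<rho>) \<le> v s" "v s \<le> v \<rho>" using \<rho> by (auto intro!: mono)
    moreover have "circle_rep c y = y"
    proof (cases "y = c + pi")
      case True
      \<comment> \<open>At the right end of the closed window the representative jumps to
        \<open>c - pi\<close>. The strict bound on the distance from \<open>v s\<close> to
        \<open>c\<close> rules this case out.\<close>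
      have "circle_rep c y = y - 2 * pi * of_int 1"
        by (rule circle_rep_unique) (use True in auto)
      then show ?thesis using True s vlt[of s] by auto
    next
      case False
      then show ?thesis using that by (intro circle_rep_id) auto
    qed
    ultimately show False using that s by auto
  qed
  have "((\<lambda>s. vector_derivative v (at s) *\<^sub>R ?g (v s)) has_integral integral {v (-\<rho>)..v \<rho>} ?g) {-\<rho>..\<rho>}"
  proof (rule has_integral_substitution)
    show "v ` {-\<rho>..\<rho>} \<subseteq> {v (-\<rho>)..v \<rho>}" using \<rho> by (auto intro!: mono)
    show "(v has_real_derivative vector_derivative v (at s)) (at s within {-\<rho>..\<rho>})" if "s \<in> {-\<rho>..\<rho>}" for s
      using v'[of s] \<rho> that by (auto intro: DERIV_subset)
  qed (use \<rho> cont in \<open>auto intro!: mono\<close>)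
  then have "integral {v (-\<rho>)..v \<rho>} ?g = integral {-\<rho>..\<rho>} (\<lambda>s. vector_derivative v (at s) *\<^sub>R ?g (v s))"
    by (simp add: integral_unique)
  also have "\<dots> = integral {-\<rho>..\<rho>} (\<lambda>s. vector_derivative v (at s) *\<^sub>R (h (v s) * k s))"
  proof (rule integral_cong)
    fix s assume "s \<in> {-\<rho>..\<rho>}"
    then have s: "s \<in> {-r<..<r}" using \<rho> by auto
    then have "circle_rep c (v s) = v s" using vlt[OF s] by (intro circle_rep_id) auto
    then show "vector_derivative v (at s) *\<^sub>R ?g (v s) = vector_derivative v (at s) *\<^sub>R (h (v s) * k s)"
      using transport_at[OF chart s] by simp
  qed
  finally have sub: "integral {v (-\<rho>)..v \<rho>} ?g =
      integral {-\<rho>..\<rho>} (\<lambda>s. vector_derivative v (at s) *\<^sub>R (h (v s) * k s))" .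
  let ?I = "{v (-\<rho>)..v \<rho>}"
  have "((\<lambda>y. if y \<in> ?I then ?g y else 0) has_integral integral ?I ?g) {c - pi..c + pi}"
  proof (rule has_integral_on_superset)
    have "(?g has_integral integral ?I ?g) ?I"
      by (intro integrable_integral integrable_continuous_interval cont)
    then show "((\<lambda>y. if y \<in> ?I then ?g y else 0) has_integral integral ?I ?g) ?I"
      by (rule has_integral_eq[rotated]) simp
    show "?I \<subseteq> {c - pi..c + pi}"
      using vlt[of "-\<rho>"] vlt[of \<rho>] \<rho> by auto
  qed auto
  then have "(?g has_integral integral ?I ?g) {c - pi..c + pi}"
    by (rule has_integral_eq[rotated]) (use zero in simp)
  moreover have "c + pi = c - pi + 2 * pi" by simp
  ultimately have "integral {c - pi..c - pi + 2 * pi} ?g = integral ?I ?g"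
    by (metis integral_unique)
  moreover have "integral {c - pi..c - pi + 2 * pi} ?g = integral {0..2 * pi} ?g"
    by (rule integral_periodic_shift) (use h cont in \<open>auto simp: transport_periodic\<close>)
  ultimately show ?thesis using sub by simp
qed

text \<open>The matrix unit from \<open>(m1, c1)\<close> to \<open>(m2, c2)\<close>. In the
  coordinate \<open>s\<close> the operator is multiplication by the cutoff \<open>b\<close> after
  pulling back along \<open>v1\<close>; hence on the circle it is a weighted composition with
  \<open>v1\<close> after \<open>u2\<close>.\<close>

lemma transfer_observable:
  fixes R :: "real \<Rightarrow> real" and m1 m2 :: int
  assumes R: "smooth_on_circle R" and p: "p \<ge> 1" and \<epsilon>: "\<epsilon> \<in> {1, -1}"
    and c1: "(of_int m1)\<^sup>2 = R c1" "\<And>k. 1 \<le> k \<Longrightarrow> k < p \<Longrightarrow> nderiv k R c1 = 0" "sgn (nderiv p R c1) = \<epsilon>"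
    and c2: "(of_int m2)\<^sup>2 = R c2" "\<And>k. 1 \<le> k \<Longrightarrow> k < p \<Longrightarrow> nderiv k R c2 = 0" "sgn (nderiv p R c2) = \<epsilon>"
    and "c2 \<in> circle"
  obtains T where "mode_operator m1 m2 T \<in> observables R"
    "\<And>f. smooth_on_circle f \<Longrightarrow> smooth_on_circle (T f)"
    "\<And>f y. y \<in> circle \<Longrightarrow> R y = (of_int m2)\<^sup>2 \<Longrightarrow> T f y = (if y = c2 then f c1 else 0)"
proof -
  have RU: "smooth_on UNIV R" and Rper: "\<And>t. R (t + 2 * pi) = R t"
    using R by (auto simp: smooth_on_circle_iff)
  obtain r1 u1 v1 where ch1': "normal_chart R p \<epsilon> c1 r1 u1 v1"
    using exists_normal_chart[OF RU p c1(2,3) \<epsilon>] .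
  obtain r2 u2 v2 where ch2': "normal_chart R p \<epsilon> c2 r2 u2 v2"
    using exists_normal_chart[OF RU p c2(2,3) \<epsilon>] .
  define r where "r = min r1 r2"
  have "r1 > 0" "r2 > 0" using ch1' ch2' by (auto simp: normal_chart_def)
  then have r: "r > 0" "r \<le> r1" "r \<le> r2" by (auto simp: r_def)
  have ch1: "normal_chart R p \<epsilon> c1 r u1 v1" and ch2: "normal_chart R p \<epsilon> c2 r u2 v2"
    using normal_chart_shrink ch1' ch2' r by blast+
  have v0: "v1 0 = c1" "v2 0 = c2"
    and sv: "smooth_on {-r<..<r} v1" "smooth_on {-r<..<r} v2"
    and v'pos: "\<And>s. s \<in> {-r<..<r} \<Longrightarrow> vector_derivative v1 (at s) > 0"
    and Rv: "\<And>s. s \<in> {-r<..<r} \<Longrightarrow> R (v1 s) = R c1 + \<epsilon> * s ^ p"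
      "\<And>s. s \<in> {-r<..<r} \<Longrightarrow> R (v2 s) = R c2 + \<epsilon> * s ^ p"
    using ch1 ch2 by (auto simp: normal_chart_def)
  define \<rho> where "\<rho> = r / 2"
  have \<rho>: "0 < \<rho>" "\<rho> < r" using r by (auto simp: \<rho>_def)
  obtain b :: "real \<Rightarrow> real" where b: "smooth_on UNIV b" "b 0 = 1" "\<And>s. \<bar>s\<bar> \<ge> \<rho> \<Longrightarrow> b s = 0"
    using exists_smooth_bump[OF \<rho>(1)] by blast
  define k where "k = (\<lambda>f s. complex_of_real (b s) * f (v1 s))"
  \<comment> \<open>The weight of the adjoint: substitution through \<open>v2\<close> creates the
    Jacobian \<open>v2'\<close>, and the return through \<open>v1\<close> has to be compensated by
    \<open>1 / v1'\<close>.\<close>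
  define w where "w = (\<lambda>s. b s * (vector_derivative v2 (at s) * inverse (vector_derivative v1 (at s))))"
  define k' where "k' = (\<lambda>h s. complex_of_real (w s) * h (v2 s))"
  define T where "T = (\<lambda>f. transport c2 r u2 v2 (k f))"
  define T' where "T' = (\<lambda>h. transport c1 r u1 v1 (k' h))"
  have of_real: "smooth_on S (\<lambda>s. complex_of_real (g s))" if "open S" "smooth_on S g" for S g
    by (rule smooth_on_linear[OF bounded_linear_of_real that])
  have bS: "smooth_on {-r<..<r} b" using b(1) smooth_on_subset by blast
  have ks: "smooth_on {-r<..<r} (k f)" if "smooth_on UNIV f" for f
    unfolding k_def by (intro smooth_on_mult of_real bS smooth_on_compose[OF that] sv) auto
  have w: "smooth_on {-r<..<r} w"
    unfolding w_def by (intro smooth_on_mult bS smooth_on_deriv sv smooth_on_inverse v'pos) auto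
  have k's: "smooth_on {-r<..<r} (k' h)" if "smooth_on UNIV h" for h
    unfolding k'_def by (intro smooth_on_mult of_real w smooth_on_compose[OF that] sv) auto
  have k0: "k f s = 0" "k' f s = 0" if "\<rho> \<le> \<bar>s\<bar>" for f s
    using b(3)[OF that] by (simp_all add: k_def k'_def w_def)
  have T: "smooth_on_circle (T f)" "smooth_on_circle (T' f)" if "smooth_on_circle f" for f
  proof -
    have f: "smooth_on UNIV f" using that by (simp add: smooth_on_circle_iff)
    show "smooth_on_circle (T f)"
      unfolding T_def by (rule smooth_on_circle_transport[OF ch2 ks[OF f] \<rho>(2) k0(1)])
    show "smooth_on_circle (T' f)"
      unfolding T'_def by (rule smooth_on_circle_transport[OF ch1 k's[OF f] \<rho>(2) k0(2)])
  qed
  have Tcases: "(\<exists>s\<in>{-r<..<r}. circle_rep c2 y = v2 s \<and> (\<forall>f. T f y = k f s)) \<or>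
      circle_rep c2 y \<notin> v2 ` {-r<..<r} \<and> (\<forall>f. T f y = 0)" for y
    unfolding T_def using transport_at[OF ch2] transport_off by blast
  have adj: "integral {0..2 * pi} (\<lambda>y. cnj (h y) * T f y) = integral {0..2 * pi} (\<lambda>y. cnj (T' h y) * f y)"
    if f: "smooth_on_circle f" and h: "smooth_on_circle h" for f h
  proof -
    have fh: "smooth_on UNIV f" "smooth_on UNIV h" "smooth_on UNIV (\<lambda>y. cnj (h y))"
      "\<And>t. f (t + 2 * pi) = f t" "\<And>t. h (t + 2 * pi) = h t"
      using f h smooth_on_linear[OF bounded_linear_cnj, of UNIV h] by (auto simp: smooth_on_circle_iff)
    have "integral {0..2 * pi} (\<lambda>y. cnj (h y) * T f y) =
        integral {-\<rho>..\<rho>} (\<lambda>s. vector_derivative v2 (at s) *\<^sub>R (cnj (h (v2 s)) * k f s))"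
      unfolding T_def
      by (rule integral_transport[OF ch2 ks[OF fh(1)] \<rho> k0(1)])
        (simp_all add: fh(5) smooth_on_continuous_on[OF fh(3)])
    also have "\<dots> = integral {-\<rho>..\<rho>} (\<lambda>s. vector_derivative v1 (at s) *\<^sub>R (f (v1 s) * k' (\<lambda>y. cnj (h y)) s))"
    proof (rule integral_cong)
      fix s assume "s \<in> {-\<rho>..\<rho>}"
      then have "vector_derivative v1 (at s) > 0" using \<rho> by (intro v'pos) auto
      then show "vector_derivative v2 (at s) *\<^sub>R (cnj (h (v2 s)) * k f s) =
          vector_derivative v1 (at s) *\<^sub>R (f (v1 s) * k' (\<lambda>y. cnj (h y)) s)"
        by (simp add: k_def k'_def w_def scaleR_conv_of_real field_simps)
    qed
    also have "\<dots> = integral {0..2 * pi} (\<lambda>y. f y * T' (\<lambda>y. cnj (h y)) y)"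
      unfolding T'_def
      by (rule integral_transport[OF ch1 k's[OF fh(3)] \<rho> k0(2), symmetric])
        (simp_all add: fh(4) smooth_on_continuous_on[OF fh(1)])
    \<comment> \<open>The weight \<open>w\<close> is real, so conjugation passes through
      \<open>T'\<close>.\<close>
    also have "\<dots> = integral {0..2 * pi} (\<lambda>y. cnj (T' h y) * f y)"
      by (intro integral_cong) (simp add: T'_def transport_def k'_def)
    finally show ?thesis .
  qed
  have comm: "T (\<lambda>y. exp (- \<i> * of_real (t * ((of_int m1)\<^sup>2 - R y))) * f y) =
      (\<lambda>y. exp (- \<i> * of_real (t * ((of_int m2)\<^sup>2 - R y))) * T f y)" for t f
  proof
    fix y
    show "T (\<lambda>y. exp (- \<i> * of_real (t * ((of_int m1)\<^sup>2 - R y))) * f y) y =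
      exp (- \<i> * of_real (t * ((of_int m2)\<^sup>2 - R y))) * T f y"
      using Tcases[of y]
    proof
      assume "\<exists>s\<in>{-r<..<r}. circle_rep c2 y = v2 s \<and> (\<forall>f. T f y = k f s)"
      then obtain s where s: "s \<in> {-r<..<r}" "circle_rep c2 y = v2 s" "\<And>f. T f y = k f s" by blast
      have "R y = R (v2 s)" using periodic_circle_rep[of R c2 y, OF Rper] s(2) by simp
      \<comment> \<open>Both sides equal \<open>- \<epsilon> * s ^ p\<close>. This is where the two
        points must share order and sign.\<close>
      then have "(of_int m2)\<^sup>2 - R y = (of_int m1)\<^sup>2 - R (v1 s)"
        using Rv[OF s(1)] c1(1) c2(1) by simp
      then show ?thesis by (simp only: s(3) k_def mult.left_commute)
    qed simp
  qed
  have Tlin: "T (\<lambda>y. f y + g y) = (\<lambda>y. T f y + T g y)" "T (\<lambda>y. a * f y) = (\<lambda>y. a * T f y)" for f g a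
    by (auto simp: T_def transport_def k_def distrib_left fun_eq_iff)
  have "mode_operator m1 m2 T \<in> observables R"
    by (rule mode_operator_observable[OF R T(1) T(2) Tlin(1) Tlin(2) adj comm])
  moreover have "T f y = (if y = c2 then f c1 else 0)" if y: "y \<in> circle" "R y = (of_int m2)\<^sup>2" for f y
  proof -
    have c2rep: "circle_rep c2 c2 = c2" by (rule circle_rep_id) auto
    from Tcases[of y] show ?thesis
    proof
      assume "\<exists>s\<in>{-r<..<r}. circle_rep c2 y = v2 s \<and> (\<forall>f. T f y = k f s)"
      then obtain s where s: "s \<in> {-r<..<r}" "circle_rep c2 y = v2 s" "\<And>f. T f y = k f s" by blast
      have "R c2 = R (v2 s)"
        using periodic_circle_rep[of R c2 y, OF Rper] s(2) y(2) c2(1) by simp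
      \<comment> \<open>By the normal form, a point of the chart at which \<open>R\<close> takes its
        central value has coordinate 0; no other solution is hit.\<close>
      then have "s = 0" using Rv(2)[OF s(1)] \<epsilon> by auto
      then have "y = c2"
        using circle_rep_inj[OF y(1) \<open>c2 \<in> circle\<close>, of c2] s(2) v0(2) c2rep by simp
      then show ?thesis using s(3)[of f] \<open>s = 0\<close> b(2) v0(1) by (simp add: k_def)
    next
      assume off: "circle_rep c2 y \<notin> v2 ` {-r<..<r} \<and> (\<forall>f. T f y = 0)"
      have "y \<noteq> c2"
      proof
        assume "y = c2"
        then have "circle_rep c2 y = v2 0" using c2rep v0 by simp
        moreover have "0 \<in> {-r<..<r}" using r by simp
        ultimately show False using off by blast
      qed
      then show ?thesis using off by simp
    qed
  qed
  ultimately show ?thesis using that T(1) by blast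
qed

section \<open>Irreducibility\<close>

text \<open>An even order is not 1, so these solutions are stationary points. Admissibility then
  provides a nonvanishing derivative, so the minimum in \<open>order_at\<close> is attained;
  finiteness of the solution sets below has the same origin.\<close>

lemma signed_solutions_facts:
  assumes adm: "admissible_potential R" and "even p" and \<epsilon>: "\<epsilon> \<in> {1, -1}"
    and y: "y \<in> signed_solutions R p \<epsilon> q"
  shows "p \<ge> 1" "nderiv 1 R y = 0" "\<And>k. 1 \<le> k \<Longrightarrow> k < p \<Longrightarrow> nderiv k R y = 0"
    "nderiv p R y \<noteq> 0"
proof -
  have ord: "order_at R y = p" and sgn: "sgn (nderiv p R y) = \<epsilon>"
    using y by (auto simp: signed_solutions_def)
  show "nderiv 1 R y = 0"
  proof (rule ccontr)
    assume "nderiv 1 R y \<noteq> 0"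
    then have "order_at R y = 1"
      unfolding order_at_def by (intro Least_equality) auto
    with ord have "p = 1" by simp
    with \<open>even p\<close> show False by simp
  qed
  then have "\<exists>n\<ge>1. nderiv n R y \<noteq> 0"
    using adm unfolding admissible_potential_def by blast
  then obtain n where n: "n \<ge> 1" "nderiv n R y \<noteq> 0" by blast
  show "p \<ge> 1"
    using LeastI[of "\<lambda>p. 1 \<le> p \<and> nderiv p R y \<noteq> 0" n] n ord by (simp add: order_at_def)
  show "nderiv k R y = 0" if "1 \<le> k" "k < p" for k
    using not_less_Least[of k "\<lambda>p. 1 \<le> p \<and> nderiv p R y \<noteq> 0"] that ord by (auto simp: order_at_def)
  show "nderiv p R y \<noteq> 0" using sgn \<epsilon> by auto
qed

lemma finite_signed_solutions:
  assumes "admissible_potential R" "even p" "\<epsilon> \<in> {1, -1}"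
  shows "finite (signed_solutions R p \<epsilon> q)"
proof (rule finite_subset)
  show "signed_solutions R p \<epsilon> q \<subseteq> {y \<in> circle. nderiv 1 R y = 0}"
    using signed_solutions_facts(2)[OF assms] by (auto simp: signed_solutions_def solutions_def)
qed (use assms(1) in \<open>simp add: admissible_potential_def\<close>)

text \<open>The value 0 off the test space matches the convention of \<open>rigging_map\<close>. A
  solution \<open>y\<close> for \<open>q > 0\<close> gives two such functionals, one for each of the
  modes \<open>q\<close> and \<open>-q\<close>.\<close>

definition point_functional :: "int \<Rightarrow> real \<Rightarrow> haux \<Rightarrow> complex" where
  "point_functional m y g = (if g \<in> test_space then mode g m y else 0)"

text \<open>Expands a vector of the quantised space in evaluation functionals, with all dependence
  on the vector in the scalar coefficients. As \<open>S\<close> may be any finite superset of the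
  support, a singleton serves for the image under \<open>mode_map\<close>.\<close>

lemma rigging_map_of_modes:
  assumes "c \<in> mode_families" "finite S" "{m. c m \<noteq> (\<lambda>_. 0)} \<subseteq> S"
  shows "rigging_map R p \<epsilon> (of_modes c) = (\<lambda>g. \<Sum>m\<in>S. \<Sum>y\<in>signed_solutions R p \<epsilon> (nat \<bar>m\<bar>).
    (of_real ((2 * pi)\<^sup>2) * cnj (c m y) / of_real (\<bar>nderiv p R y\<bar> powr (1 / real p))) * point_functional m y g)"
proof
  fix g
  let ?Y = "\<lambda>m. signed_solutions R p \<epsilon> (nat \<bar>m\<bar>)"
  let ?t = "\<lambda>m y. cnj (c m y) * mode g m y / of_real (\<bar>nderiv p R y\<bar> powr (1 / real p))"
  have "c m = (\<lambda>_. 0)" if "m \<notin> S" for m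
    using assms(3) that by blast
  then have "(\<Sum>\<^sub>\<infinity>m. \<Sum>y\<in>?Y m. ?t m y) = (\<Sum>\<^sub>\<infinity>m\<in>S. \<Sum>y\<in>?Y m. ?t m y)"
    by (intro infsum_cong_neutral) auto
  then show "rigging_map R p \<epsilon> (of_modes c) g = (\<Sum>m\<in>S. \<Sum>y\<in>?Y m.
    (of_real ((2 * pi)\<^sup>2) * cnj (c m y) / of_real (\<bar>nderiv p R y\<bar> powr (1 / real p))) * point_functional m y g)"
    using assms(2)
    by (simp add: rigging_map_def mode_of_modes[OF assms(1)] point_functional_def sum_distrib_left mult_ac)
qed

lemma linear_subspace_add: "linear_subspace V \<Longrightarrow> \<xi> \<in> V \<Longrightarrow> \<zeta> \<in> V \<Longrightarrow> (\<lambda>g. \<xi> g + \<zeta> g) \<in> V"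
  and linear_subspace_scale: "linear_subspace V \<Longrightarrow> \<xi> \<in> V \<Longrightarrow> (\<lambda>g. a * \<xi> g) \<in> V"
  by (simp_all add: linear_subspace_def)

lemma linear_subspace_sum:
  assumes "linear_subspace V" "finite I" "\<And>i. i \<in> I \<Longrightarrow> F i \<in> V"
  shows "(\<lambda>g. \<Sum>i\<in>I. F i g) \<in> V"
  using assms(2,3)
proof (induction I rule: finite_induct)
  case empty
  then show ?case using assms(1) by (simp add: linear_subspace_def)
next
  case (insert i I)
  then have "F i \<in> V" "(\<lambda>g. \<Sum>i\<in>I. F i g) \<in> V" by auto
  then have "(\<lambda>g. F i g + (\<Sum>i\<in>I. F i g)) \<in> V"
    by (rule linear_subspace_add[OF assms(1)])
  then show ?case using insert(1,2) by simp
qed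

theorem mainTheorem4:
  fixes R :: "real \<Rightarrow> real" and p :: nat and \<epsilon> :: real
  assumes "admissible_potential R"
    and "p \<in> orders R" and "even p"
    and "\<epsilon> \<in> {1, -1}"
    and "\<exists>q. signed_solutions R p \<epsilon> q \<noteq> {}"
  shows "\<forall>V. linear_subspace V \<and> V \<subseteq> raq_space R p \<epsilon> \<and> V \<noteq> {\<lambda>_. 0} \<and> invariant_subspace R p \<epsilon> V
           \<longrightarrow> V = raq_space R p \<epsilon>"
proof (intro allI impI)
  fix V
  assume "linear_subspace V \<and> V \<subseteq> raq_space R p \<epsilon> \<and> V \<noteq> {\<lambda>_. 0} \<and> invariant_subspace R p \<epsilon> V"
  then have lin: "linear_subspace V" and sub: "V \<subseteq> raq_space R p \<epsilon>" and "V \<noteq> {\<lambda>_. 0}"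
    and inv: "invariant_subspace R p \<epsilon> V"
    by auto
  let ?\<eta> = "rigging_map R p \<epsilon>" and ?Y = "\<lambda>m. signed_solutions R p \<epsilon> (nat \<bar>m\<bar>)"
  have R: "smooth_on_circle R"
    using assms(1) by (simp add: admissible_potential_def)
  note facts = signed_solutions_facts[OF assms(1,3,4)]
  have Ysol: "y \<in> circle" "(of_int m)\<^sup>2 = R y" "sgn (nderiv p R y) = \<epsilon>" if "y \<in> ?Y m" for m y
    using that by (auto simp: signed_solutions_def solutions_def)
  have "(\<lambda>_. 0) \<in> V" using lin by (simp add: linear_subspace_def)
  with \<open>V \<noteq> {\<lambda>_. 0}\<close> obtain \<xi> where \<xi>: "\<xi> \<in> V" "\<xi> \<noteq> (\<lambda>_. 0)" by blast
  then obtain c where c: "c \<in> mode_families" "\<xi> = ?\<eta> (of_modes c)"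
    using sub by (auto simp: raq_space_def test_space_eq)
  have "\<exists>m1. \<exists>y1\<in>?Y m1. c m1 y1 \<noteq> 0"
  proof (rule ccontr)
    assume "\<not> ?thesis"
    then have "\<xi> = (\<lambda>_. 0)"
      unfolding c(2) rigging_map_of_modes[OF c(1) mode_families_finite[OF c(1)] order_refl]
      by (auto intro!: sum.neutral)
    with \<xi> show False by simp
  qed
  then obtain m1 y1 where y1: "y1 \<in> ?Y m1" "c m1 y1 \<noteq> 0" by blast
  \<comment> \<open>A single source \<open>(m1, y1)\<close> with nonzero coefficient suffices: the
    observable for the target \<open>(m2, y2)\<close> depends on that choice, and no assumption
    relates the two pairs, so they may coincide.\<close>
  have point: "point_functional m2 y2 \<in> V" if y2: "y2 \<in> ?Y m2" for m2 y2
  proof -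
    obtain T where T: "mode_operator m1 m2 T \<in> observables R"
      "\<And>f. smooth_on_circle f \<Longrightarrow> smooth_on_circle (T f)"
      "\<And>f y. y \<in> circle \<Longrightarrow> R y = (of_int m2)\<^sup>2 \<Longrightarrow> T f y = (if y = y2 then f y1 else 0)"
      using transfer_observable[OF R facts(1)[OF y2] assms(4) Ysol(2)[OF y1(1)] facts(3)[OF y1(1)]
          Ysol(3)[OF y1(1)] Ysol(2)[OF y2] facts(3)[OF y2] Ysol(3)[OF y2] Ysol(1)[OF y2]] by blast
    let ?d = "mode_map m1 m2 T c"
    have d: "?d \<in> mode_families" by (intro mode_map_in c T(2))
    have "(of_modes c, of_modes ?d) \<in> mode_operator m1 m2 T"
      using c(1) by (auto simp: mode_operator_def)
    then have inV: "?\<eta> (of_modes ?d) \<in> V"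
      using inv T(1) c \<xi>(1) unfolding invariant_subspace_def test_space_eq by blast
    let ?a = "of_real ((2 * pi)\<^sup>2) * cnj (c m1 y1) / complex_of_real (\<bar>nderiv p R y2\<bar> powr (1 / real p))"
    have "?\<eta> (of_modes ?d) = (\<lambda>g. \<Sum>m\<in>{m2}. \<Sum>y\<in>?Y m.
        (of_real ((2 * pi)\<^sup>2) * cnj (?d m y) / of_real (\<bar>nderiv p R y\<bar> powr (1 / real p))) * point_functional m y g)"
      by (rule rigging_map_of_modes[OF d]) (auto simp: mode_map_def)
    \<comment> \<open>The operator evaluates to \<open>c m1 y1\<close> at \<open>y2\<close> and to
      zero at every other solution in the mode \<open>m2\<close>, so one term of the expansion
      remains.\<close>
    also have "\<dots> = (\<lambda>g. \<Sum>y\<in>?Y m2. if y = y2 then ?a * point_functional m2 y2 g else 0)"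
      using T(3) Ysol by (auto simp: mode_map_def fun_eq_iff intro!: sum.cong)
    also have "\<dots> = (\<lambda>g. ?a * point_functional m2 y2 g)"
      using y2 finite_signed_solutions[OF assms(1,3,4)] by simp
    finally have "(\<lambda>g. ?a * point_functional m2 y2 g) \<in> V" using inV by simp
    \<comment> \<open>The scalar \<open>?a\<close> is invertible: its numerator contains
      \<open>c m1 y1\<close>, which is nonzero, and its denominator is nonzero because the
      derivative of order \<open>p\<close> at \<open>y2\<close> does not vanish.\<close>
    from linear_subspace_scale[OF lin this, of "inverse ?a"] show ?thesis
      using y1(2) facts(4)[OF y2] by (simp add: mult.assoc[symmetric])
  qed
  have "?\<eta> (of_modes d) \<in> V" if d: "d \<in> mode_families" for d
    unfolding rigging_map_of_modes[OF d mode_families_finite[OF d] order_refl]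
    by (intro linear_subspace_sum[OF lin] linear_subspace_scale[OF lin] point mode_families_finite[OF d]
        finite_signed_solutions[OF assms(1,3,4)])
  then show "V = raq_space R p \<epsilon>"
    using sub by (auto simp: raq_space_def test_space_eq)
qed

end
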